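(* Let $X,Y$ be computable Banach spaces, both different from $\{0\}$. Then $\mathsf{UBT}_{X,Y}\equiv_W\mathsf{C_{\mathbb N}}$.
   Context: A represented space is a pair $(X,\delta_X)$ with $\delta_X:\subseteq\mathbb N^{\mathbb N}\to X$ a partial surjection. For a partial multi-valued map $f:\subseteq X\rightrightarrows Y$ between represented spaces, a realizer of $f$ is a partial function $F:\subseteq\mathbb N^{\mathbb N}\to\mathbb N^{\mathbb N}$ with $\delta_Y(F(p))\in f(\delta_X(p))$ for all $p\in\mathrm{dom}(f\circ\delta_X)$. We write $f\le_W g$ (Weihrauch reducibility) if there are computable partial functions $H,K:\subseteq\mathbb N^{\mathbb N}\to\mathbb N^{\mathbb N}$ such that for every realizer $G$ of $g$ the function $p\mapsto H\langle p,G(K(p))\rangle$ is a realizer of $f$, where $\langle\cdot,\cdot\rangle$ is a standard computable pairing on $\mathbb N^{\mathbb N}$. $\equiv_W$ is the induced equivalence. $\mathcal A_-(\mathbb N)$ is the set of subsets of $\mathbb N$, where $p$ names $A$ iff $\mathbb N\setminus A=\{n:n+1\in\mathrm{range}(p)\}$; $\mathsf{C_{\mathbb N}}:\subseteq\mathcal A_-(\mathbb N)\rightrightarrows\mathbb N$, $A\mapsto A$, on non-empty $A$. A computable Banach space is a (real) Banach space together with a sequence whose linear span is dense, such that the induced metric space is a complete computable metric space; points are represented by the Cauchy representation $\delta_X$. $\mathcal C(X,Y)$ is the space of continuous $T:X\to Y$ with the function space representation $[\delta_X\to\delta_Y]$, and sequences are represented by tupling. $\mathsf{UBT}_{X,Y}:\subseteq\mathcal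 C(X,Y)^{\mathbb N}\rightrightarrows\mathbb N$, $(T_i)_i\mapsto\{M\in\mathbb N:\sup_i\|T_i\|\le M\}$, defined on all sequences of linear bounded operators $T_i:X\to Y$ such that $\{\|T_ix\|:i\in\mathbb N\}$ is bounded for every $x\in X$. *)

theory Defs
  imports "HOL-Analysis.Analysis" "HOL-Library.Nat_Bijection"
begin

type_synonym baire = "nat \<Rightarrow> nat"

fun prec :: "(nat list \<Rightarrow> nat) \<Rightarrow> (nat list \<Rightarrow> nat) \<Rightarrow> nat \<Rightarrow> nat list \<Rightarrow> nat" where
  "prec g h 0 ys = g ys"
| "prec g h (Suc y) ys = h (y # prec g h y ys # ys)"

text \<open>recfn n f: f is a total recursive function of arity n (only its values on
 argument lists of length n matter).\<close>
inductive recfn :: "nat \<Rightarrow> (nat list \<Rightarrow> nat) \<Rightarrow> bool" where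
  rf_zero: "recfn n (\<lambda>_. 0)"
| rf_succ: "recfn 1 (\<lambda>xs. Suc (hd xs))"
| rf_proj: "i < n \<Longrightarrow> recfn n (\<lambda>xs. xs ! i)"
| rf_comp: "recfn m g \<Longrightarrow> length fs = m \<Longrightarrow> (\<forall>i<m. recfn n (fs ! i))
            \<Longrightarrow> recfn n (\<lambda>xs. g (map (\<lambda>f. f xs) fs))"
| rf_prec: "recfn n g \<Longrightarrow> recfn (n + 2) h
            \<Longrightarrow> recfn (Suc n) (\<lambda>xs. prec g h (hd xs) (tl xs))"
| rf_mu: "recfn (Suc n) g \<Longrightarrow> (\<forall>xs. length xs = n \<longrightarrow> (\<exists>y. g (y # xs) = 0))
            \<Longrightarrow> recfn n (\<lambda>xs. LEAST y. g (y # xs) = 0)"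

definition recursive :: "(nat \<Rightarrow> nat) \<Rightarrow> bool" where
  "recursive f \<longleftrightarrow> (\<exists>g. recfn 1 g \<and> (\<forall>x. f x = g [x]))"

definition prefix_code :: "baire \<Rightarrow> nat \<Rightarrow> nat" where
  "prefix_code p k = list_encode (map p [0..<k])"

text \<open>The partial continuous function coded by q (Kleene associate style):
 output digit n is q(n, w) - 1 for the shortest prefix w of the input with q(n,w) > 0.\<close>
definition eta :: "baire \<Rightarrow> baire \<Rightarrow> baire option" where
  "eta q p = (if \<forall>n. \<exists>k. 0 < q (prod_encode (n, prefix_code p k))
     then Some (\<lambda>n. q (prod_encode (n, prefix_code p
                     (LEAST k. 0 < q (prod_encode (n, prefix_code p k))))) - 1)
     else None)"

definition computable_partial :: "(baire \<Rightarrow> baire option) \<Rightarrow> bool" where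
  "computable_partial F \<longleftrightarrow>
     (\<exists>q. recursive q \<and> (\<forall>p r. F p = Some r \<longrightarrow> eta q p = Some r))"

definition bpair :: "baire \<Rightarrow> baire \<Rightarrow> baire" where
  "bpair p r = (\<lambda>n. if even n then p (n div 2) else r (n div 2))"

type_synonym 'a rep = "baire \<Rightarrow> 'a option"

definition realizer :: "'a rep \<Rightarrow> 'b rep \<Rightarrow> 'a set \<Rightarrow> ('a \<Rightarrow> 'b set) \<Rightarrow> (baire \<Rightarrow> baire option) \<Rightarrow> bool" where
  "realizer dX dY D f F \<longleftrightarrow>
     (\<forall>p x. dX p = Some x \<and> x \<in> D \<longrightarrow>
        (\<exists>q y. F p = Some q \<and> dY q = Some y \<and> y \<in> f x))"

definition W_le ::
  "'a rep \<Rightarrow> 'b rep \<Rightarrow> 'a set \<Rightarrow> ('a \<Rightarrow> 'b set) \<Rightarrow>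
   'c rep \<Rightarrow> 'd rep \<Rightarrow> 'c set \<Rightarrow> ('c \<Rightarrow> 'd set) \<Rightarrow> bool" where
  "W_le dX dY D f dU dV E g \<longleftrightarrow>
     (\<exists>H K. computable_partial H \<and> computable_partial K \<and>
        (\<forall>G. realizer dU dV E g G \<longrightarrow>
           realizer dX dY D f
             (\<lambda>p. case K p of None \<Rightarrow> None
                  | Some r \<Rightarrow> (case G r of None \<Rightarrow> None
                               | Some s \<Rightarrow> H (bpair p s)))))"

definition W_equiv ::
  "'a rep \<Rightarrow> 'b rep \<Rightarrow> 'a set \<Rightarrow> ('a \<Rightarrow> 'b set) \<Rightarrow>
   'c rep \<Rightarrow> 'd rep \<Rightarrow> 'c set \<Rightarrow> ('c \<Rightarrow> 'd set) \<Rightarrow> bool" where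
  "W_equiv dX dY D f dU dV E g \<longleftrightarrow>
     W_le dX dY D f dU dV E g \<and> W_le dU dV E g dX dY D f"

definition nat_rep :: "nat rep" where
  "nat_rep p = Some (p 0)"

definition neg_rep :: "nat set rep" where
  "neg_rep p = Some {n. Suc n \<notin> range p}"

definition CN_dom :: "nat set set" where
  "CN_dom = {A. A \<noteq> {}}"

definition CN_map :: "nat set \<Rightarrow> nat set" where
  "CN_map A = A"

definition rat_dec :: "nat \<Rightarrow> real" where
  "rat_dec n = (case prod_decode n of (a, b) \<Rightarrow> real_of_int (int_decode a) / real (Suc b))"

definition computable_real_seq :: "(nat \<Rightarrow> real) \<Rightarrow> bool" where
  "computable_real_seq x \<longleftrightarrow>
     (\<exists>r. recursive r \<and> (\<forall>n k. \<bar>x n - rat_dec (r (prod_encode (n, k)))\<bar> \<le> inverse (2 ^ k)))"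

definition ratcomb :: "(nat \<Rightarrow> 'a::real_normed_vector) \<Rightarrow> nat \<Rightarrow> 'a" where
  "ratcomb e n = (let l = list_decode n in \<Sum>i<length l. rat_dec (l ! i) *\<^sub>R e i)"

text \<open>Computable Banach space: fundamental sequence e with dense linear span such that
 the induced metric space (X, d, ratcomb e) is a computable metric space.\<close>
definition computable_banach :: "(nat \<Rightarrow> 'a::banach) \<Rightarrow> bool" where
  "computable_banach e \<longleftrightarrow>
     closure (span (range e)) = UNIV \<and>
     computable_real_seq (\<lambda>n. case prod_decode n of (i, j) \<Rightarrow> dist (ratcomb e i) (ratcomb e j))"

definition cauchy_rep :: "(nat \<Rightarrow> 'a::banach) \<Rightarrow> 'a rep" where
  "cauchy_rep e p =
     (if \<exists>x. \<forall>k. dist (ratcomb e (p k)) x \<le> inverse (2 ^ k)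
      then Some (THE x. \<forall>k. dist (ratcomb e (p k)) x \<le> inverse (2 ^ k)) else None)"

definition fun_rep :: "'a::topological_space rep \<Rightarrow> 'b::topological_space rep \<Rightarrow> ('a \<Rightarrow> 'b) rep" where
  "fun_rep dX dY q =
     (let P = (\<lambda>T. continuous_on UNIV T \<and>
                 (\<forall>p x. dX p = Some x \<longrightarrow> (\<exists>r. eta q p = Some r \<and> dY r = Some (T x))))
      in if \<exists>T. P T then Some (THE T. P T) else None)"

definition seq_rep :: "'a rep \<Rightarrow> (nat \<Rightarrow> 'a) rep" where
  "seq_rep d p =
     (if \<forall>i. d (\<lambda>n. p (prod_encode (i, n))) \<noteq> None
      then Some (\<lambda>i. the (d (\<lambda>n. p (prod_encode (i, n))))) else None)"

definition UBT_dom :: "(nat \<Rightarrow> ('a::real_normed_vector \<Rightarrow> 'b::real_normed_vector)) set" where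
  "UBT_dom = {T. (\<forall>i. bounded_linear (T i)) \<and> (\<forall>x. bounded (range (\<lambda>i. norm (T i x))))}"

definition UBT_map :: "(nat \<Rightarrow> ('a::real_normed_vector \<Rightarrow> 'b::real_normed_vector)) \<Rightarrow> nat set" where
  "UBT_map T = {M. \<forall>i. onorm (T i) \<le> real M}"

end

theory Submission
  imports Defs
begin

text \<open>
  \<^bold>\<open>Upper bound.\<close> The strict inequality \<open>M < \<parallel>T\<^sub>i\<parallel>\<close> is witnessed by a finite part of the name of \<open>T\<^sub>i\<close>:
  evaluate \<open>T\<^sub>i\<close> on the constant name of a rational combination \<open>x\<close> and compare approximations of
  \<open>\<parallel>T\<^sub>i x\<parallel>\<close> and \<open>M \<parallel>x\<parallel>\<close>. Enumerating witnesses gives a negative name of the set of all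
  bounds, which is non-empty by the uniform boundedness theorem.

  \<^bold>\<open>Lower bound.\<close> Let \<open>p\<close> enumerate the complement of \<open>A\<close> and let \<open>s\<^sub>i\<close> be the last stage up to \<open>i\<close> at which the
  least number not yet enumerated changed. If \<open>f\<close> is a computable functional of norm one and
  \<open>\<parallel>y\<parallel> \<ge> 1\<close>, a uniform bound of the operators \<open>T\<^sub>i x = s\<^sub>i f(x) y\<close> bounds all \<open>s\<^sub>i\<close>, so the least
  missing number at that stage is the minimum of \<open>A\<close>.

  \<^bold>\<open>The functional.\<close> No Hahn-Banach extension is needed: \<open>f\<close> is the Gateaux derivative of the norm at a
  point \<open>z\<close>. Second differences of the norm along a line telescope, so near every point there are
  points where the norm is almost differentiable in a given direction. An effective Baire category
  argument (Mazur's theorem) yields a computable \<open>z \<noteq> 0\<close> where it is differentiable in all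
  directions, and then \<open>f z = \<parallel>z\<parallel>\<close>.
\<close>

section \<open>Recursive functions\<close>

text \<open>The rules of \<open>recfn\<close> yield specific terms, including their values on lists
  of the wrong length. Passing to agreement on lists of length n allows closure rules for functions
  written in any convenient form.\<close>

definition recf :: "nat \<Rightarrow> (nat list \<Rightarrow> nat) \<Rightarrow> bool" where
  "recf n f \<longleftrightarrow> (\<exists>g. recfn n g \<and> (\<forall>xs. length xs = n \<longrightarrow> f xs = g xs))"

lemma recf_cong: "recf n f \<Longrightarrow> (\<And>xs. length xs = n \<Longrightarrow> f xs = g xs) \<Longrightarrow> recf n g"
  unfolding recf_def by auto

lemma recf_zero: "recf n (\<lambda>_. 0)"
  unfolding recf_def using rf_zero by blast

lemma recf_proj: "i < n \<Longrightarrow> recf n (\<lambda>xs. xs ! i)"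
  unfolding recf_def using rf_proj by blast

lemma recf_comp:
  assumes g: "recf (length fs) g" and fs: "\<And>f. f \<in> set fs \<Longrightarrow> recf n f"
  shows "recf n (\<lambda>xs. g (map (\<lambda>f. f xs) fs))"
proof -
  obtain g' where g': "recfn (length fs) g'" "\<And>xs. length xs = length fs \<Longrightarrow> g xs = g' xs"
    using g unfolding recf_def by blast
  have "\<forall>f\<in>set fs. \<exists>f'. recfn n f' \<and> (\<forall>xs. length xs = n \<longrightarrow> f xs = f' xs)"
    using fs unfolding recf_def by blast
  then obtain c where c: "\<And>f. f \<in> set fs \<Longrightarrow> recfn n (c f)"
      "\<And>f xs. f \<in> set fs \<Longrightarrow> length xs = n \<Longrightarrow> f xs = c f xs"
    by metis
  have "recfn n (\<lambda>xs. g' (map (\<lambda>f. f xs) (map c fs)))"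
    by (rule rf_comp[OF g'(1)]) (use c in auto)
  moreover have "g (map (\<lambda>f. f xs) fs) = g' (map (\<lambda>f. f xs) (map c fs))" if "length xs = n" for xs
  proof -
    have "map (\<lambda>f. f xs) fs = map (\<lambda>f. f xs) (map c fs)"
      unfolding map_map comp_def using c(2) that by simp
    moreover have "g (map (\<lambda>f. f xs) fs) = g' (map (\<lambda>f. f xs) fs)"
      by (rule g'(2)) simp
    ultimately show ?thesis by (simp only:)
  qed
  ultimately show ?thesis unfolding recf_def by blast
qed

lemma recf_comp1: "recf 1 (\<lambda>ys. g (ys ! 0)) \<Longrightarrow> recf n f \<Longrightarrow> recf n (\<lambda>xs. g (f xs))"
  using recf_comp[of "[f]" "\<lambda>ys. g (ys ! 0)" n] by simp

lemma recf_comp2: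
  "recf 2 (\<lambda>ys. g (ys ! 0) (ys ! 1)) \<Longrightarrow> recf n f1 \<Longrightarrow> recf n f2 \<Longrightarrow> recf n (\<lambda>xs. g (f1 xs) (f2 xs))"
  using recf_comp[of "[f1, f2]" "\<lambda>ys. g (ys ! 0) (ys ! 1)" n] by (auto simp: numeral_2_eq_2)

lemma recf_Suc: "recf n f \<Longrightarrow> recf n (\<lambda>xs. Suc (f xs))"
proof (rule recf_comp1[where g = "Suc"])
  show "recf 1 (\<lambda>ys. Suc (ys ! 0))"
    unfolding recf_def by (rule exI, rule conjI, rule rf_succ) (auto simp: length_Suc_conv)
qed

lemma recf_const: "recf n (\<lambda>_. k)"
  by (induction k) (auto intro: recf_zero recf_Suc)

lemma prec_rec_nat: "prec g h y ys = rec_nat (g ys) (\<lambda>k r. h (k # r # ys)) y"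
  by (induction y) simp_all

lemma recf_rec_nat:
  assumes g: "recf n g" and h: "recf (n + 2) h" and f: "recf n f"
  shows "recf n (\<lambda>xs. rec_nat (g xs) (\<lambda>k r. h (k # r # xs)) (f xs))"
proof -
  obtain g' where g': "recfn n g'" "\<And>xs. length xs = n \<Longrightarrow> g xs = g' xs"
    using g unfolding recf_def by blast
  obtain h' where h': "recfn (n + 2) h'" "\<And>xs. length xs = n + 2 \<Longrightarrow> h xs = h' xs"
    using h unfolding recf_def by blast
  have eq: "rec_nat (g xs) (\<lambda>k r. h (k # r # xs)) y = prec g' h' y xs" if "length xs = n" for xs y
    unfolding prec_rec_nat using g'(2) h'(2) that by (induction y) auto
  have "recf (Suc n) (\<lambda>xs. rec_nat (g (tl xs)) (\<lambda>k r. h (k # r # tl xs)) (hd xs))"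
    unfolding recf_def by (rule exI, rule conjI, rule rf_prec[OF g'(1) h'(1)]) (auto intro: eq)
  \<comment> \<open>Substituting \<open>f\<close> followed by all n projections makes
    \<open>f xs\<close> the counter and leaves \<open>xs\<close> as the parameters.\<close>
  then have "recf (length (f # map (\<lambda>i xs. xs ! i) [0..<n]))
      (\<lambda>xs. rec_nat (g (tl xs)) (\<lambda>k r. h (k # r # tl xs)) (hd xs))"
    by simp
  from recf_comp[OF this, of n] show ?thesis
  proof (rule recf_cong)
    show "recf n f'" if "f' \<in> set (f # map (\<lambda>i xs. xs ! i) [0..<n])" for f'
      using that f by (auto intro: recf_proj)
  next
    fix xs :: "nat list" assume "length xs = n"
    then have "map (\<lambda>f. f xs) (f # map (\<lambda>i xs. xs ! i) [0..<n]) = f xs # xs"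
      by (auto simp: comp_def map_nth)
    then show "rec_nat (g (tl (map (\<lambda>f. f xs) (f # map (\<lambda>i xs. xs ! i) [0..<n]))))
        (\<lambda>k r. h (k # r # tl (map (\<lambda>f. f xs) (f # map (\<lambda>i xs. xs ! i) [0..<n]))))
        (hd (map (\<lambda>f. f xs) (f # map (\<lambda>i xs. xs ! i) [0..<n]))) =
      rec_nat (g xs) (\<lambda>k r. h (k # r # xs)) (f xs)"
      by (simp only: list.sel)
  qed
qed

lemma recf_LEAST:
  assumes g: "recf (Suc n) g" and ex: "\<And>xs. length xs = n \<Longrightarrow> \<exists>y. g (y # xs) = 0"
  shows "recf n (\<lambda>xs. LEAST y. g (y # xs) = 0)"
proof -
  obtain g' where g': "recfn (Suc n) g'" "\<And>xs. length xs = Suc n \<Longrightarrow> g xs = g' xs"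
    using g unfolding recf_def by blast
  show ?thesis unfolding recf_def
    by (rule exI, rule conjI, rule rf_mu[OF g'(1)]) (use g' ex in auto)
qed

section \<open>Arithmetic and the inverse of the Cantor pairing\<close>

lemma recf_add: "recf n f \<Longrightarrow> recf n g \<Longrightarrow> recf n (\<lambda>xs. f xs + g xs)"
proof (rule recf_comp2[where g = "(+)"])
  have "recf 2 (\<lambda>xs. rec_nat (xs ! 0) (\<lambda>k r. (\<lambda>zs. Suc (zs ! 1)) (k # r # xs)) (xs ! 1))"
    by (intro recf_rec_nat recf_Suc recf_proj) auto
  moreover have "rec_nat a (\<lambda>k r. Suc r) b = a + b" for a b by (induction b) auto
  ultimately show "recf 2 (\<lambda>xs. xs ! 0 + xs ! 1)" by simp
qed

lemma recf_pred: "recf n f \<Longrightarrow> recf n (\<lambda>xs. f xs - 1)"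
proof (rule recf_comp1[where g = "\<lambda>x. x - 1"])
  have "recf 1 (\<lambda>xs. rec_nat 0 (\<lambda>k r. (\<lambda>zs. zs ! 0) (k # r # xs)) (xs ! 0))"
    by (intro recf_rec_nat recf_zero recf_proj) auto
  moreover have "rec_nat 0 (\<lambda>k r. k) b = b - 1" for b by (induction b) auto
  ultimately show "recf 1 (\<lambda>xs. xs ! 0 - 1)" by simp
qed

lemma recf_diff: "recf n f \<Longrightarrow> recf n g \<Longrightarrow> recf n (\<lambda>xs. f xs - g xs)"
proof (rule recf_comp2[where g = "(-)"])
  have "recf 2 (\<lambda>xs. rec_nat (xs ! 0) (\<lambda>k r. (\<lambda>zs. zs ! 1 - 1) (k # r # xs)) (xs ! 1))"
    by (intro recf_rec_nat recf_pred recf_proj) auto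
  moreover have "rec_nat a (\<lambda>k r. r - 1) b = a - b" for a b :: nat by (induction b) auto
  ultimately show "recf 2 (\<lambda>xs. xs ! 0 - xs ! 1)" by simp
qed

lemma recf_mult: "recf n f \<Longrightarrow> recf n g \<Longrightarrow> recf n (\<lambda>xs. f xs * g xs)"
proof (rule recf_comp2[where g = "(*)"])
  have "recf 2 (\<lambda>xs. rec_nat 0 (\<lambda>k r. (\<lambda>zs. zs ! 1 + zs ! 2) (k # r # xs)) (xs ! 1))"
    by (intro recf_rec_nat recf_add recf_zero recf_proj) auto
  moreover have "rec_nat 0 (\<lambda>k r. r + a) b = a * b" for a b :: nat by (induction b) auto
  ultimately show "recf 2 (\<lambda>xs. xs ! 0 * xs ! 1)" by simp
qed

lemma recf_triangle: "recf n f \<Longrightarrow> recf n (\<lambda>xs. triangle (f xs))"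
proof (rule recf_comp1[where g = "triangle"])
  have "recf 1 (\<lambda>xs. rec_nat 0 (\<lambda>k r. (\<lambda>zs. zs ! 1 + Suc (zs ! 0)) (k # r # xs)) (xs ! 0))"
    by (intro recf_rec_nat recf_add recf_Suc recf_zero recf_proj) auto
  moreover have "rec_nat 0 (\<lambda>k r. r + Suc k) b = triangle b" for b by (induction b) auto
  ultimately show "recf 1 (\<lambda>xs. triangle (xs ! 0))" by simp
qed

lemma recf_prod_encode: "recf n f \<Longrightarrow> recf n g \<Longrightarrow> recf n (\<lambda>xs. prod_encode (f xs, g xs))"
  by (simp add: prod_encode_def, intro recf_add recf_triangle)

text \<open>Since \<open>prod_encode (a, b) = triangle (a + b) + a\<close>, the diagonal a + b is
  the least s with c below \<open>triangle (Suc s)\<close>. The truncated difference turns this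
  inequality into a zero test, as minimisation requires.\<close>

definition diagonal :: "nat \<Rightarrow> nat" where
  "diagonal c = (LEAST s. Suc c - triangle (Suc s) = 0)"

lemma le_triangle: "n \<le> triangle n"
  by (induction n) auto

lemma triangle_mono: "m \<le> n \<Longrightarrow> triangle m \<le> triangle n"
  by (induction n rule: nat_induct) (auto simp: le_Suc_eq)

lemma diagonal_prod_encode: "diagonal (prod_encode (a, b)) = a + b"
  unfolding diagonal_def prod_encode_def
proof (rule Least_equality)
  show "Suc (case (a, b) of (m, n) \<Rightarrow> triangle (m + n) + m) - triangle (Suc (a + b)) = 0"
    by simp
next
  fix s assume *: "Suc (case (a, b) of (m, n) \<Rightarrow> triangle (m + n) + m) - triangle (Suc s) = 0"
  show "a + b \<le> s"
  proof (rule ccontr)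
    assume "\<not> a + b \<le> s"
    then have "triangle (Suc s) \<le> triangle (a + b)" by (intro triangle_mono) auto
    with * show False by simp
  qed
qed

lemma recf_diagonal: "recf n f \<Longrightarrow> recf n (\<lambda>xs. diagonal (f xs))"
proof (rule recf_comp1[where g = "diagonal"])
  have "recf 1 (\<lambda>xs. LEAST y. (\<lambda>ys. Suc (ys ! 1) - triangle (Suc (ys ! 0))) (y # xs) = 0)"
  proof (intro recf_LEAST recf_diff recf_Suc recf_triangle recf_proj)
    fix xs :: "nat list"
    show "\<exists>y. Suc ((y # xs) ! 1) - triangle (Suc ((y # xs) ! 0)) = 0"
      using le_triangle[of "Suc (xs ! 0)"] by (intro exI[of _ "xs ! 0"]) simp
  qed auto
  then show "recf 1 (\<lambda>xs. diagonal (xs ! 0))" unfolding diagonal_def by simp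
qed

lemma fst_prod_decode: "fst (prod_decode c) = c - triangle (diagonal c)"
  and snd_prod_decode: "snd (prod_decode c) = diagonal c - fst (prod_decode c)"
proof -
  obtain a b where c: "c = prod_encode (a, b)"
    by (metis prod_decode_inverse surj_pair)
  show "fst (prod_decode c) = c - triangle (diagonal c)"
       "snd (prod_decode c) = diagonal c - fst (prod_decode c)"
    by (simp_all add: c diagonal_prod_encode) (simp_all add: prod_encode_def)
qed

lemma recf_fst: "recf n f \<Longrightarrow> recf n (\<lambda>xs. fst (prod_decode (f xs)))"
  unfolding fst_prod_decode by (intro recf_diff recf_triangle recf_diagonal)

lemma recf_snd: "recf n f \<Longrightarrow> recf n (\<lambda>xs. snd (prod_decode (f xs)))"
  unfolding snd_prod_decode by (intro recf_diff recf_fst recf_diagonal)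

lemma recursive_iff_recf: "recursive f \<longleftrightarrow> recf 1 (\<lambda>xs. f (xs ! 0))"
proof
  assume "recursive f"
  then obtain g where "recfn 1 g" "\<forall>x. f x = g [x]" unfolding recursive_def by blast
  then show "recf 1 (\<lambda>xs. f (xs ! 0))" unfolding recf_def by (auto simp: length_Suc_conv)
next
  assume "recf 1 (\<lambda>xs. f (xs ! 0))"
  then obtain g where g: "recfn 1 g" "\<And>xs. length xs = 1 \<Longrightarrow> f (xs ! 0) = g xs"
    unfolding recf_def by blast
  then show "recursive f" unfolding recursive_def using g(2)[of "[_]"] by (intro exI[of _ g]) auto
qed

lemma recursive_rec_nat:
  assumes "recursive f" "recursive g" "recursive h"
  shows "recursive (\<lambda>x. rec_nat (f x) (\<lambda>n r. g (prod_encode (n, prod_encode (r, x)))) (h x))"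
proof -
  have "recf 1 (\<lambda>xs. rec_nat (f (xs ! 0)) (\<lambda>n r. (\<lambda>zs. g (prod_encode (zs ! 0, prod_encode (zs ! 1, zs ! 2)))) (n # r # xs)) (h (xs ! 0)))"
    
    by (intro recf_rec_nat[where h = "\<lambda>zs. g (prod_encode (zs ! 0, prod_encode (zs ! 1, zs ! 2)))"]
          assms[unfolded recursive_iff_recf] recf_comp1[OF assms(2)[unfolded recursive_iff_recf]]
          recf_prod_encode recf_proj) auto
  then show ?thesis unfolding recursive_iff_recf by simp
qed

lemma recursive_LEAST:
  assumes "recursive f" "\<And>x. \<exists>y. f (prod_encode (y, x)) = 0"
  shows "recursive (\<lambda>x. LEAST y. f (prod_encode (y, x)) = 0)"
proof -
  have "recf 1 (\<lambda>xs. LEAST y. (\<lambda>zs. f (prod_encode (zs ! 0, zs ! 1))) (y # xs) = 0)"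
    
    by (intro recf_LEAST[where g = "\<lambda>zs. f (prod_encode (zs ! 0, zs ! 1))"]
          recf_comp1[OF assms(1)[unfolded recursive_iff_recf]] recf_prod_encode recf_proj) (use assms(2) in auto)
  then show ?thesis unfolding recursive_iff_recf by simp
qed

lemma recursive_comp: "recursive g \<Longrightarrow> recursive f \<Longrightarrow> recursive (\<lambda>x. g (f x))"
  unfolding recursive_iff_recf by (rule recf_comp1)

lemma recursive_prod_encode: "recursive f \<Longrightarrow> recursive g \<Longrightarrow> recursive (\<lambda>x. prod_encode (f x, g x))"
  unfolding recursive_iff_recf by (rule recf_prod_encode)

lemma recursive_basic:
  "recursive (\<lambda>x. x)" "recursive (\<lambda>_. k)" "recursive Suc"
  "recursive (\<lambda>x. fst (prod_decode x))" "recursive (\<lambda>x. snd (prod_decode x))"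
  unfolding recursive_iff_recf
  by (intro recf_const recf_proj recf_Suc recf_fst recf_snd zero_less_one)+

section \<open>Computable functions on coded types\<close>

text \<open>Codings are bijections, so every number decodes to an object and a search over numbers
  is a search over objects. The instances agree with the encodings used in \<open>eta\<close>,
  \<open>rat_dec\<close> and \<open>ratcomb\<close>.\<close>

class coded =
  fixes enc :: "'a \<Rightarrow> nat" and dec :: "nat \<Rightarrow> 'a"
  assumes dec_enc [simp]: "dec (enc x) = x" and enc_dec [simp]: "enc (dec n) = n"

instantiation nat :: coded
begin
definition "enc (n::nat) = n"
definition "dec (n::nat) = n"
instance by standard (simp_all add: enc_nat_def dec_nat_def)
end

instantiation int :: coded
begin
definition "enc (i::int) = int_encode i"
definition "dec n = int_decode n"
instance by standard (simp_all add: enc_int_def dec_int_def)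
end

instantiation prod :: (coded, coded) coded
begin
definition "enc (p::'a \<times> 'b) = prod_encode (enc (fst p), enc (snd p))"
definition "dec n = (dec (fst (prod_decode n)) :: 'a, dec (snd (prod_decode n)) :: 'b)"
instance by standard (simp_all add: enc_prod_def dec_prod_def)
end

instantiation list :: (coded) coded
begin
definition "enc (xs::'a list) = list_encode (map enc xs)"
definition "dec n = (map dec (list_decode n) :: 'a list)"
instance by standard (simp_all add: enc_list_def dec_list_def comp_def)
end

lemma enc_inject: "enc x = enc y \<longleftrightarrow> x = y"
  by (metis dec_enc)

definition computable :: "('a::coded \<Rightarrow> 'b::coded) \<Rightarrow> bool" where
  "computable f \<longleftrightarrow> recursive (\<lambda>n. enc (f (dec n)))"

definition decidable :: "('a::coded \<Rightarrow> bool) \<Rightarrow> bool" where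
  "decidable P \<longleftrightarrow> computable (\<lambda>x. if P x then 1 else 0 :: nat)"

named_theorems comp_intro

lemma computable_id [comp_intro]: "computable (\<lambda>x. x)"
  by (simp add: computable_def recursive_basic)

lemma computable_const [comp_intro]: "computable (\<lambda>_. k)"
  by (simp add: computable_def recursive_basic)

lemma computable_comp: "computable g \<Longrightarrow> computable f \<Longrightarrow> computable (\<lambda>x. g (f x))"
  unfolding computable_def by (drule recursive_comp, assumption) simp

lemma computable_Pair [comp_intro]:
  "computable f \<Longrightarrow> computable g \<Longrightarrow> computable (\<lambda>x. (f x, g x))"
  unfolding computable_def by (simp add: enc_prod_def recursive_prod_encode)

lemma computable_comp2:
  "computable (\<lambda>y. F (fst y) (snd y)) \<Longrightarrow> computable f \<Longrightarrow> computable g \<Longrightarrow> computable (\<lambda>x. F (f x) (g x))"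
  using computable_comp[of "\<lambda>y. F (fst y) (snd y)" "\<lambda>x. (f x, g x)"] by (simp add: computable_Pair)

lemma computable_enc [comp_intro]: "computable f \<Longrightarrow> computable (\<lambda>x. enc (f x))"
  and computable_dec [comp_intro]: "computable g \<Longrightarrow> computable (\<lambda>x. dec (g x))"
  unfolding computable_def by (simp_all add: enc_nat_def)

lemma computable_fst [comp_intro]: "computable f \<Longrightarrow> computable (\<lambda>x. fst (f x))"
proof (rule computable_comp[where g = fst])
  show "computable (fst :: 'b \<times> 'c \<Rightarrow> _)"
    unfolding computable_def by (simp add: dec_prod_def recursive_basic)
qed

lemma computable_snd [comp_intro]: "computable f \<Longrightarrow> computable (\<lambda>x. snd (f x))"
proof (rule computable_comp[where g = snd])
  show "computable (snd :: 'b \<times> 'c \<Rightarrow> _)"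
    unfolding computable_def by (simp add: dec_prod_def recursive_basic)
qed

lemma computable_of_recursive: "recursive f \<Longrightarrow> computable f"
  unfolding computable_def by (simp add: enc_nat_def dec_nat_def)

lemma recursive_of_computable: "computable (f :: nat \<Rightarrow> nat) \<Longrightarrow> recursive f"
  unfolding computable_def by (simp add: enc_nat_def dec_nat_def)

lemma computable_Suc [comp_intro]: "computable f \<Longrightarrow> computable (\<lambda>x. Suc (f x))"
  by (rule computable_comp[of Suc]) (intro computable_of_recursive recursive_basic)

lemma computable_add [comp_intro]:
    "computable f \<Longrightarrow> computable g \<Longrightarrow> computable (\<lambda>x. f x + g x :: nat)"
  and computable_diff [comp_intro]:
    "computable f \<Longrightarrow> computable g \<Longrightarrow> computable (\<lambda>x. f x - g x :: nat)"
  and computable_mult [comp_intro]: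
    "computable f \<Longrightarrow> computable g \<Longrightarrow> computable (\<lambda>x. f x * g x :: nat)"
  unfolding computable_def recursive_iff_recf enc_nat_def
  by (simp_all add: recf_add recf_diff recf_mult)

text \<open>The recursion is run on codes, decoding the accumulator before each step and encoding it
  afterwards; hence the accumulator may have any coded type.\<close>

lemma computable_rec_nat [comp_intro]:
  assumes "computable f" "computable (\<lambda>y. G (fst y) (fst (snd y)) (snd (snd y)))" "computable h"
  shows "computable (\<lambda>x. rec_nat (f x) (\<lambda>n r. G n r x) (h x))"
proof -
  define g where "g = (\<lambda>k. (\<lambda>y. enc (G (fst y) (fst (snd y)) (snd (snd y)))) (dec k))"
  have "enc (rec_nat (f x) (\<lambda>n r. G n r x) m) =
      rec_nat (enc (f x)) (\<lambda>n r. g (prod_encode (n, prod_encode (r, enc x)))) m" for x m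
  proof (induction m)
    case (Suc m)
    have "dec (rec_nat (enc (f x)) (\<lambda>n r. g (prod_encode (n, prod_encode (r, enc x)))) m) =
        rec_nat (f x) (\<lambda>n r. G n r x) m"
      by (simp flip: Suc.IH)
    then show ?case by (simp add: g_def dec_prod_def dec_nat_def)
  qed simp
  then have *: "enc (rec_nat (f (dec k)) (\<lambda>n r. G n r (dec k)) (h (dec k))) =
      rec_nat (enc (f (dec k))) (\<lambda>n r. g (prod_encode (n, prod_encode (r, k)))) (h (dec k))" for k
    by (metis enc_dec)
  have "recursive g"
    using assms(2) unfolding computable_def g_def .
  with assms(1,3) show ?thesis
    unfolding computable_def * by (intro recursive_rec_nat) (simp_all add: enc_nat_def)
qed

section \<open>Decidable predicates, case distinction and search\<close>

lemma decidable_le [comp_intro]: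
  "computable f \<Longrightarrow> computable g \<Longrightarrow> decidable (\<lambda>x. f x \<le> (g x :: nat))"
proof -
  have *: "(if a \<le> b then 1 else 0) = 1 - (a - b)" for a b :: nat by auto
  show "computable f \<Longrightarrow> computable g \<Longrightarrow> ?thesis"
    unfolding decidable_def * by (intro comp_intro)
qed

lemma decidable_not [comp_intro]: "decidable P \<Longrightarrow> decidable (\<lambda>x. \<not> P x)"
proof -
  have *: "(if \<not> a then 1 else 0) = 1 - (if a then 1 else (0::nat))" for a by auto
  show "decidable P \<Longrightarrow> ?thesis"
    unfolding decidable_def * by (intro comp_intro)
qed

lemma decidable_conj [comp_intro]: "decidable P \<Longrightarrow> decidable Q \<Longrightarrow> decidable (\<lambda>x. P x \<and> Q x)"
proof -
  have *: "(if a \<and> b then 1 else 0) = (if a then 1 else 0) * (if b then 1 else (0::nat))" for a b by auto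
  show "decidable P \<Longrightarrow> decidable Q \<Longrightarrow> ?thesis"
    unfolding decidable_def * by (intro comp_intro)
qed

lemma decidable_disj [comp_intro]: "decidable P \<Longrightarrow> decidable Q \<Longrightarrow> decidable (\<lambda>x. P x \<or> Q x)"
  using decidable_not[OF decidable_conj[OF decidable_not decidable_not], of P Q] by simp

lemma decidable_less [comp_intro]:
  "computable f \<Longrightarrow> computable g \<Longrightarrow> decidable (\<lambda>x. f x < (g x :: nat))"
  unfolding not_le[symmetric] by (intro comp_intro)

lemma decidable_eq [comp_intro]:
  "computable f \<Longrightarrow> computable g \<Longrightarrow> decidable (\<lambda>x. f x = g x)"
proof -
  have *: "f x = g x \<longleftrightarrow> enc (f x) \<le> enc (g x) \<and> enc (g x) \<le> enc (f x)" for x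
    using enc_inject by (metis eq_iff)
  show "computable f \<Longrightarrow> computable g \<Longrightarrow> ?thesis"
    unfolding * by (intro comp_intro)
qed

lemma computable_If [comp_intro]:
  "decidable P \<Longrightarrow> computable f \<Longrightarrow> computable g \<Longrightarrow> computable (\<lambda>x. if P x then f x else g x)"
proof -
  \<comment> \<open>A conditional is a recursion of length zero or one that ignores counter and
    accumulator.\<close>
  have *: "(if P x then f x else g x) = rec_nat (g x) (\<lambda>_ _. f x) (if P x then 1 else 0)" for x by simp
  assume a: "decidable P" "computable f" "computable g"
  show ?thesis
    unfolding * using a(1)[unfolded decidable_def]
    by (intro computable_rec_nat[where G = "\<lambda>_ _. f"] computable_comp[OF a(2)] a comp_intro)
qed

lemma decidable_comp: "decidable P \<Longrightarrow> computable f \<Longrightarrow> decidable (\<lambda>x. P (f x))"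
  unfolding decidable_def by (rule computable_comp)

lemma decidable_all_less [comp_intro]:
  assumes P: "decidable (\<lambda>y. P (fst y :: nat) (snd y :: 'a::coded))" and h: "computable h"
  shows "decidable (\<lambda>x. \<forall>i<h x. P i x)"
proof -
  have *: "(if \<forall>i<m. P i x then 1 else 0) = rec_nat 1 (\<lambda>i r. if P i x then r else (0::nat)) m" for m and x :: 'a
    by (induction m) (auto simp: less_Suc_eq)
  have "decidable (\<lambda>y::nat \<times> nat \<times> 'a. P (fst y) (snd (snd y)))"
    using decidable_comp[OF P, of "\<lambda>y::nat \<times> nat \<times> 'a. (fst y, snd (snd y))"]
    by (simp add: comp_intro)
  then show ?thesis
    unfolding decidable_def * by (intro comp_intro h) (simp add: decidable_def)
qed

lemma computable_LEAST [comp_intro]: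
  assumes P: "decidable (\<lambda>y. P (fst y) (snd y))" and ex: "\<And>x. \<exists>n. P n x"
  shows "computable (\<lambda>x. LEAST n::nat. P n x)"
proof -
  define f where "f k = (if P (dec (fst (prod_decode k))) (dec (snd (prod_decode k))) then 0 else 1 :: nat)" for k
  have "computable (\<lambda>y. if P (fst y) (snd y) then 0 else 1 :: nat)"
    by (intro comp_intro P)
  then have f: "recursive f"
    unfolding computable_def f_def dec_prod_def by (simp add: enc_nat_def)
  have *: "P n (dec k) \<longleftrightarrow> f (prod_encode (n, k)) = 0" for n k
    by (simp add: f_def dec_nat_def)
  show ?thesis
    unfolding computable_def enc_nat_def * by (rule recursive_LEAST[OF f]) (use ex * in blast)
qed

text \<open>Taking the witness of least code, rather than an arbitrary one, makes the choice
  computable in the parameters of P.\<close>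

definition search :: "('a::coded \<Rightarrow> bool) \<Rightarrow> 'a" where
  "search P = dec (LEAST n. P (dec n))"

lemma search: "\<exists>a. P a \<Longrightarrow> P (search P)"
  unfolding search_def by (rule LeastI_ex) (metis dec_enc)

lemma computable_search:
  assumes P: "decidable (\<lambda>y. P (fst y) (snd y))" and ex: "\<And>x. \<exists>a. P a x"
  shows "computable (\<lambda>x. search (\<lambda>a. P a x))"
proof -
  have "decidable (\<lambda>y::nat \<times> 'b. P (dec (fst y)) (snd y))"
    using decidable_comp[OF P, of "\<lambda>y::nat \<times> 'b. (dec (fst y), snd y)"] by (simp add: comp_intro)
  moreover have "\<exists>n. P (dec n) x" for x
    using ex by (metis dec_enc)
  ultimately show ?thesis
    unfolding search_def by (intro comp_intro)
qed

lemma computable_power [comp_intro]: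
  assumes f: "computable f" and g: "computable g"
  shows "computable (\<lambda>x. f x ^ g x :: nat)"
proof (rule computable_comp2[OF _ f g])
  have *: "a ^ b = rec_nat 1 (\<lambda>_ r. r * a) b" for a b :: nat
    by (induction b) auto
  show "computable (\<lambda>y::nat \<times> nat. fst y ^ snd y)"
    unfolding * by (intro comp_intro)
qed

lemma computable_div [comp_intro]:
  assumes f: "computable f" and g: "computable g"
  shows "computable (\<lambda>x. f x div g x :: nat)"
proof (rule computable_comp2[OF _ f g])
  \<comment> \<open>The disjunct \<open>b = 0\<close> keeps the search total and gives 0, the
    conventional value of a division by zero.\<close>
  have *: "a div b = (LEAST q. a < Suc q * b \<or> b = 0)" for a b :: nat
  proof (cases "b = 0")
    case False
    have "a div b < Suc q \<longleftrightarrow> a < Suc q * b" for q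
      using False by (metis div_less_iff_less_mult gr0I)
    then show ?thesis using False by (auto intro!: Least_equality[symmetric] simp: less_Suc_eq_le[symmetric])
  qed simp
  have "\<exists>q. a < Suc q * b \<or> b = 0" for a b :: nat
    by (cases b) (auto intro!: exI[of _ a])
  moreover have "decidable (\<lambda>y::nat \<times> nat \<times> nat. fst (snd y) < Suc (fst y) * snd (snd y) \<or> snd (snd y) = 0)"
    by (intro comp_intro)
  ultimately show "computable (\<lambda>y::nat \<times> nat. fst y div snd y)"
    unfolding * by (intro comp_intro) auto
qed

section \<open>Integers and lists\<close>

lemma int_encode_int: "int_encode (int n) = 2 * n"
  and int_encode_neg: "int_encode (- int (Suc n)) = Suc (2 * n)"
  by (simp_all add: int_encode_def sum_encode_def)

text \<open>Nonnegative integers have even codes and negative ones odd codes, so the code of a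
  difference is explicit. The other integer operations are reduced to differences of
  naturals.\<close>

lemma computable_int_diff:
  "computable f \<Longrightarrow> computable g \<Longrightarrow> computable (\<lambda>x. int (f x) - int (g x))"
proof -
  have *: "int a - int b = dec (if b \<le> a then 2 * (a - b) else 2 * (b - a) - 1)" for a b
  proof (cases "b \<le> a")
    case True
    then have "int_encode (int a - int b) = 2 * (a - b)"
      using int_encode_int[of "a - b"] by (simp add: of_nat_diff)
    then show ?thesis using True by (metis dec_enc enc_int_def)
  next
    case False
    then have "int_encode (int a - int b) = 2 * (b - a) - 1"
      using int_encode_neg[of "b - a - 1"] by (simp add: of_nat_diff)
    then show ?thesis using False by (metis dec_enc enc_int_def)
  qed
  show "computable f \<Longrightarrow> computable g \<Longrightarrow> ?thesis"
    unfolding * by (intro comp_intro)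
qed

lemma computable_nat [comp_intro]: "computable f \<Longrightarrow> computable (\<lambda>x. nat (f x))"
  and computable_nat_neg: "computable f \<Longrightarrow> computable (\<lambda>x. nat (- f x))"
proof -
  have 1: "nat i = (if enc i = 2 * (enc i div 2) then enc i div 2 else 0)" for i :: int
    unfolding enc_int_def using int_encode_int[of "nat i"] int_encode_neg[of "nat (- i - 1)"]
    by (cases "i \<ge> 0") auto
  have 2: "nat (- i) = (if enc i = 2 * (enc i div 2) then 0 else Suc (enc i div 2))" for i :: int
    unfolding enc_int_def using int_encode_int[of "nat i"] int_encode_neg[of "nat (- i - 1)"]
    by (cases "i \<ge> 0") auto
  show "computable f \<Longrightarrow> computable (\<lambda>x. nat (f x))" unfolding 1 by (intro comp_intro)
  show "computable f \<Longrightarrow> computable (\<lambda>x. nat (- f x))" unfolding 2 by (intro comp_intro)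
qed

lemma computable_int [comp_intro]: "computable f \<Longrightarrow> computable (\<lambda>x. int (f x))"
  using computable_int_diff[of f "\<lambda>_. 0"] by (simp add: comp_intro)

lemma computable_int_add [comp_intro]:
    "computable f \<Longrightarrow> computable g \<Longrightarrow> computable (\<lambda>x. f x + g x :: int)"
  and computable_int_minus [comp_intro]:
    "computable f \<Longrightarrow> computable (\<lambda>x. - f x :: int)"
  and computable_int_mult [comp_intro]:
    "computable f \<Longrightarrow> computable g \<Longrightarrow> computable (\<lambda>x. f x * g x :: int)"
proof -
  have d: "i = int (nat i) - int (nat (- i))" for i by simp
  have a: "i + j = int (nat i + nat j) - int (nat (- i) + nat (- j))" for i j by simp
  have m: "- i = int (nat (- i)) - int (nat i)" for i by simp
  have t: "i * j = int (nat i * nat j + nat (- i) * nat (- j)) - int (nat i * nat (- j) + nat (- i) * nat j)" for i j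
    by (cases "i \<ge> 0"; cases "j \<ge> 0") (simp_all add: of_nat_mult)
  show "computable f \<Longrightarrow> computable g \<Longrightarrow> computable (\<lambda>x. f x + g x :: int)"
    unfolding a by (intro computable_int_diff computable_nat_neg comp_intro)
  show "computable f \<Longrightarrow> computable (\<lambda>x. - f x :: int)"
    by (subst m, intro computable_int_diff computable_nat_neg comp_intro)
  show "computable f \<Longrightarrow> computable g \<Longrightarrow> computable (\<lambda>x. f x * g x :: int)"
    by (subst t, intro computable_int_diff computable_nat_neg comp_intro)
qed

lemma enc_Nil: "enc [] = 0"
  and enc_Cons: "enc (x # xs) = Suc (prod_encode (enc x, enc xs))"
  by (simp_all add: enc_list_def)

lemma computable_Cons [comp_intro]:
  "computable f \<Longrightarrow> computable g \<Longrightarrow> computable (\<lambda>x. f x # g x)"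
proof -
  have *: "x # xs = dec (Suc (prod_encode (enc x, enc xs)))" for x :: 'b and xs
    by (metis dec_enc enc_Cons)
  have **: "prod_encode (a, b) = enc (a, b)" for a b :: nat
    by (simp add: enc_prod_def enc_nat_def)
  show "computable f \<Longrightarrow> computable g \<Longrightarrow> ?thesis"
    unfolding * ** by (intro comp_intro)
qed

lemma computable_prod_encode [comp_intro]:
  "computable f \<Longrightarrow> computable g \<Longrightarrow> computable (\<lambda>x. prod_encode (f x, g x))"
proof -
  have **: "prod_encode (a, b) = enc (a, b)" for a b :: nat
    by (simp add: enc_prod_def enc_nat_def)
  show "computable f \<Longrightarrow> computable g \<Longrightarrow> ?thesis" unfolding ** by (intro comp_intro)
qed

lemma computable_tl [comp_intro]: "computable f \<Longrightarrow> computable (\<lambda>x. tl (f x))"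
proof -
  have *: "tl xs = dec (if enc xs = 0 then 0 else snd (dec (enc xs - 1) :: nat \<times> nat))" for xs :: "'b list"
    using dec_enc[of "[] :: 'b list"] by (cases xs) (simp_all add: enc_Nil enc_Cons dec_prod_def dec_nat_def)
  show "computable f \<Longrightarrow> ?thesis" unfolding * by (intro comp_intro)
qed

lemma computable_drop [comp_intro]:
  "computable n \<Longrightarrow> computable f \<Longrightarrow> computable (\<lambda>x. drop (n x) (f x))"
proof -
  have *: "drop m xs = rec_nat xs (\<lambda>_ r. tl r) m" for m and xs :: "'b list"
    by (induction m) (simp_all add: drop_Suc flip: tl_drop)
  show "computable n \<Longrightarrow> computable f \<Longrightarrow> ?thesis" unfolding * by (intro comp_intro)
qed

lemma computable_length [comp_intro]: "computable f \<Longrightarrow> computable (\<lambda>x. length (f x))"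
proof (rule computable_comp[where g = length])
  have *: "length xs = (LEAST n. drop n xs = [])" for xs :: "'b list"
    by (rule Least_equality[symmetric]) auto
  show "computable (length :: 'b list \<Rightarrow> nat)"
    unfolding * by (intro comp_intro) (auto intro: exI[of _ "length _"])
qed

text \<open>Beyond the end of a list \<open>!\<close> has no known value. This total variant reads
  the first entry of the dropped list off its code, which is computable in all cases.\<close>

definition nth_code :: "'a::coded list \<Rightarrow> nat \<Rightarrow> 'a" where
  "nth_code xs i = dec (fst (dec (enc (drop i xs) - 1) :: nat \<times> nat))"

lemma nth_code [simp]: "i < length xs \<Longrightarrow> nth_code xs i = xs ! i"
  by (simp add: nth_code_def enc_Cons dec_prod_def dec_nat_def flip: Cons_nth_drop_Suc)

lemma computable_nth_code [comp_intro]: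
  "computable f \<Longrightarrow> computable n \<Longrightarrow> computable (\<lambda>x. nth_code (f x) (n x))"
  unfolding nth_code_def by (intro comp_intro)

lemma computable_map_upt [comp_intro]:
  fixes F :: "nat \<Rightarrow> 'a::coded \<Rightarrow> 'b::coded"
  assumes F: "computable (\<lambda>y. F (fst y) (snd y))" and h: "computable h"
  shows "computable (\<lambda>x. map (\<lambda>i. F i x) [0..<h x])"
proof -
  \<comment> \<open>Entries are prepended, so the list is filled from its end: after n steps it
    holds the entries from index m - n on.\<close>
  have "rec_nat [] (\<lambda>k r. F (m - Suc k) x # r) n = map (\<lambda>i. F i x) [m - n..<m]" if "n \<le> m" for m n x
    using that by (induction n) (auto simp: upt_conv_Cons Suc_diff_Suc)
  from this[of m m for m] have *: "map (\<lambda>i. F i x) [0..<m] = rec_nat [] (\<lambda>k r. F (m - Suc k) x # r) m" for m x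
    by simp
  have "computable (\<lambda>y::nat \<times> 'b list \<times> 'a. F (h (snd (snd y)) - Suc (fst y)) (snd (snd y)))"
    by (rule computable_comp2[OF F]) (intro comp_intro computable_comp[OF h])+
  then show ?thesis
    unfolding * by (intro comp_intro h) 
qed

section \<open>Representations\<close>

text \<open>If every positive answer is correct, it does not matter which prefix is the shortest
  with a positive answer.\<close>

lemma eta_eqI:
  assumes "\<And>n. \<exists>k. 0 < q (prod_encode (n, prefix_code p k))"
    and "\<And>n k. 0 < q (prod_encode (n, prefix_code p k)) \<Longrightarrow> q (prod_encode (n, prefix_code p k)) = Suc (r n)"
  shows "eta q p = Some r"
proof -
  have "q (prod_encode (n, prefix_code p (LEAST k. 0 < q (prod_encode (n, prefix_code p k))))) = Suc (r n)" for n
    by (rule assms(2)[OF LeastI_ex[OF assms(1)]])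
  then show ?thesis
    unfolding eta_def using assms(1) by simp
qed

text \<open>Here \<open>g n w\<close> is an algorithm for digit n that has read the prefix w: 0 asks
  for more input, and \<open>Suc\<close> marks a final answer.\<close>

lemma computable_partialI:
  fixes g :: "nat \<Rightarrow> nat list \<Rightarrow> nat"
  assumes g: "computable (\<lambda>y. g (fst y) (snd y))"
    and ex: "\<And>p r n. F p = Some r \<Longrightarrow> \<exists>k. 0 < g n (map p [0..<k])"
    and eq: "\<And>p r n k. F p = Some r \<Longrightarrow> 0 < g n (map p [0..<k]) \<Longrightarrow> g n (map p [0..<k]) = Suc (r n)"
  shows "computable_partial F"
proof -
  define q where "q c = g (fst (dec c :: nat \<times> nat list)) (snd (dec c :: nat \<times> nat list))" for c
  have "computable q"
    unfolding q_def by (rule computable_comp[OF g]) (intro comp_intro)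
  then have "recursive q" by (rule recursive_of_computable)
  moreover have "q (prod_encode (n, prefix_code p k)) = g n (map p [0..<k])" for n p k
    by (simp add: q_def prefix_code_def dec_prod_def dec_list_def dec_nat_def comp_def)
  ultimately show ?thesis
    unfolding computable_partial_def
    by (intro exI[of _ q] conjI allI impI eta_eqI) (simp_all add: ex eq)
qed

section \<open>Rational linear combinations and their density\<close>

definition q2r :: "int \<times> nat \<Rightarrow> real" where
  "q2r a = of_int (fst a) / real (Suc (snd a))"

definition qadd :: "int \<times> nat \<Rightarrow> int \<times> nat \<Rightarrow> int \<times> nat" where
  "qadd a b = (fst a * int (Suc (snd b)) + fst b * int (Suc (snd a)), Suc (snd a) * Suc (snd b) - 1)"

definition qmul :: "int \<times> nat \<Rightarrow> int \<times> nat \<Rightarrow> int \<times> nat" where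
  "qmul a b = (fst a * fst b, Suc (snd a) * Suc (snd b) - 1)"

lemma q2r_qadd: "q2r (qadd a b) = q2r a + q2r b"
  unfolding q2r_def qadd_def by (simp add: field_simps)

lemma q2r_qmul: "q2r (qmul a b) = q2r a * q2r b"
  unfolding q2r_def qmul_def by (simp add: field_simps)

text \<open>Pairs store the denominator minus one, as \<open>rat_dec\<close> does, so lists of pairs
  are exactly the codes read by \<open>ratcomb\<close>.\<close>

lemma rat_dec_q2r: "rat_dec n = q2r (dec n)"
  by (simp add: rat_dec_def q2r_def dec_prod_def dec_int_def dec_nat_def split: prod.split)

text \<open>Padding with zeros lets lists of different lengths be combined entry by entry.\<close>

definition coef :: "(int \<times> nat) list \<Rightarrow> nat \<Rightarrow> int \<times> nat" where
  "coef L i = (if i < length L then nth_code L i else (0, 0))"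

text \<open>The code of L + s M, which covers scaling, differences and steps along a line. The sum
  of the lengths is just a convenient bound for both.\<close>

definition vcomb :: "(int \<times> nat) list \<Rightarrow> int \<times> nat \<Rightarrow> (int \<times> nat) list \<Rightarrow> (int \<times> nat) list" where
  "vcomb L s M = map (\<lambda>i. qadd (coef L i) (qmul s (coef M i))) [0..<length L + length M]"

lemma computable_vcomb [comp_intro]:
  assumes "computable f" "computable g" "computable h"
  shows "computable (\<lambda>x. vcomb (f x) (g x) (h x))"
proof -
  have "computable (\<lambda>y. vcomb (fst y) (fst (snd y)) (snd (snd y)))"
    unfolding vcomb_def coef_def qadd_def qmul_def by (intro comp_intro)
  from computable_comp[OF this, of "\<lambda>x. (f x, g x, h x)"] show ?thesis
    using assms by (simp add: comp_intro)
qed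

abbreviation rvec :: "(nat \<Rightarrow> 'a::real_normed_vector) \<Rightarrow> (int \<times> nat) list \<Rightarrow> 'a" where
  "rvec e L \<equiv> ratcomb e (enc L)"

lemma rvec_sum: "length L \<le> N \<Longrightarrow> rvec e L = (\<Sum>i<N. q2r (coef L i) *\<^sub>R e i)"
proof -
  assume N: "length L \<le> N"
  have "rvec e L = (\<Sum>i<length L. q2r (coef L i) *\<^sub>R e i)"
    by (simp add: ratcomb_def enc_list_def rat_dec_q2r coef_def)
  also have "\<dots> = (\<Sum>i<N. q2r (coef L i) *\<^sub>R e i)"
    using N by (intro sum.mono_neutral_left) (auto simp: coef_def q2r_def)
  finally show ?thesis .
qed

lemma rvec_vcomb: "rvec e (vcomb L s M) = rvec e L + q2r s *\<^sub>R rvec e M"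
proof -
  let ?N = "length L + length M"
  have "rvec e (vcomb L s M) = (\<Sum>i<?N. q2r (coef (vcomb L s M) i) *\<^sub>R e i)"
    by (rule rvec_sum) (simp add: vcomb_def)
  also have "\<dots> = (\<Sum>i<?N. q2r (coef L i) *\<^sub>R e i + q2r s *\<^sub>R q2r (coef M i) *\<^sub>R e i)"
    by (rule sum.cong) (simp_all add: vcomb_def coef_def[of "map _ _"] q2r_qadd q2r_qmul scaleR_add_left)
  also have "\<dots> = rvec e L + q2r s *\<^sub>R rvec e M"
    by (simp add: rvec_sum[of L ?N] rvec_sum[of M ?N] sum.distrib scaleR_sum_right)
  finally show ?thesis .
qed

lemma rvec_Nil: "rvec e [] = 0"
  by (simp add: rvec_sum[of _ 0])

lemma ratcomb_0: "ratcomb e 0 = 0"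
  using rvec_Nil by (simp add: enc_Nil)

lemma unit_rvec: "\<exists>L. rvec e L = e i"
proof
  let ?L = "replicate i (0, 0) @ [(1, 0)]"
  have "rvec e ?L = (\<Sum>j<Suc i. q2r (coef ?L j) *\<^sub>R e j)"
    by (rule rvec_sum) simp
  also have "\<dots> = e i"
    by (simp add: coef_def nth_append q2r_def)
  finally show "rvec e ?L = e i" .
qed

lemma q2r_dense:
  assumes "0 < d" shows "\<exists>s. \<bar>q2r s - c\<bar> < d"
proof -
  obtain n where n: "1 / real (Suc n) < d"
    using assms reals_Archimedean by (metis inverse_eq_divide)
  have "\<bar>q2r (\<lfloor>c * real (Suc n)\<rfloor>, n) - c\<bar> \<le> 1 / real (Suc n)"
  proof -
    have "\<bar>of_int \<lfloor>c * real (Suc n)\<rfloor> - c * real (Suc n)\<bar> \<le> 1"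
      by linarith
    moreover have "q2r (\<lfloor>c * real (Suc n)\<rfloor>, n) - c = (of_int \<lfloor>c * real (Suc n)\<rfloor> - c * real (Suc n)) / real (Suc n)"
      by (simp add: q2r_def field_simps)
    ultimately show ?thesis by (simp add: divide_right_mono)
  qed
  with n show ?thesis using le_less_trans by blast
qed

text \<open>The closure of the rational combinations is a closed subspace, because real scalars are
  limits of rational ones. It contains each \<open>e i\<close> and therefore the closed
  span.\<close>

lemma rvec_dense:
  fixes e :: "nat \<Rightarrow> 'a::real_normed_vector"
  assumes "closure (span (range e)) = UNIV" and "0 < d"
  shows "\<exists>L. dist (rvec e L) x < d"
proof -
  define S where "S = closure (range (rvec e))"
  have cl: "x \<in> S \<longleftrightarrow> (\<forall>d>0. \<exists>L. dist (rvec e L) x < d)" for x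
    unfolding S_def closure_approachable by (auto simp: image_iff)
  have "subspace S"
  proof (rule subspaceI)
    show "0 \<in> S" unfolding cl using rvec_Nil[of e] by (metis dist_self)
  next
    fix x y assume "x \<in> S" "y \<in> S"
    show "x + y \<in> S" unfolding cl
    proof (intro allI impI)
      fix d :: real assume "0 < d"
      then obtain L M where L: "dist (rvec e L) x < d / 2" and M: "dist (rvec e M) y < d / 2"
        using \<open>x \<in> S\<close> \<open>y \<in> S\<close> unfolding cl by (meson half_gt_zero)
      have "rvec e (vcomb L (1, 0) M) = rvec e L + rvec e M"
        by (simp add: rvec_vcomb q2r_def)
      then have "dist (rvec e (vcomb L (1, 0) M)) (x + y) < d"
        using L M dist_triangle_add[of "rvec e L" "rvec e M" x y] by simp
      then show "\<exists>L. dist (rvec e L) (x + y) < d" by blast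
    qed
  next
    fix c x assume "x \<in> S"
    show "c *\<^sub>R x \<in> S" unfolding cl
    proof (intro allI impI)
      fix d :: real assume "0 < d"
      \<comment> \<open>The cap 1 bounds \<open>norm (rvec e L)\<close> by
        \<open>2 + norm x\<close>, and this bound dictates how close s must be to c.\<close>
      have "0 < min 1 (d / 2 / (1 + \<bar>c\<bar>))" using \<open>0 < d\<close> by simp
      then obtain L where L: "dist (rvec e L) x < min 1 (d / 2 / (1 + \<bar>c\<bar>))"
        using \<open>x \<in> S\<close> unfolding cl by blast
      have "0 < d / 2 / (2 + norm x)" using \<open>0 < d\<close> by (simp add: add_pos_nonneg)
      then obtain s where s: "\<bar>q2r s - c\<bar> < d / 2 / (2 + norm x)"
        using q2r_dense by blast
      have nL: "norm (rvec e L) \<le> 2 + norm x"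
        using L norm_triangle_ineq2[of "rvec e L" x] by (simp add: dist_norm)
      have "dist (rvec e (vcomb [] s L)) (c *\<^sub>R x)
          = norm ((q2r s - c) *\<^sub>R rvec e L + c *\<^sub>R (rvec e L - x))"
        by (simp add: rvec_vcomb rvec_Nil dist_norm algebra_simps)
      also have "\<dots> \<le> \<bar>q2r s - c\<bar> * norm (rvec e L) + \<bar>c\<bar> * dist (rvec e L) x"
        by (metis norm_triangle_ineq norm_scaleR dist_norm)
      also have "\<dots> < d / 2 + d / 2"
      proof (rule add_less_le_mono)
        have "\<bar>q2r s - c\<bar> * norm (rvec e L) \<le> \<bar>q2r s - c\<bar> * (2 + norm x)"
          using nL by (intro mult_left_mono) auto
        also have "\<dots> < d / 2"
          using s by (simp add: pos_less_divide_eq add_pos_nonneg algebra_simps)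
        finally show "\<bar>q2r s - c\<bar> * norm (rvec e L) < d / 2" .
        have "\<bar>c\<bar> * dist (rvec e L) x \<le> (1 + \<bar>c\<bar>) * (d / 2 / (1 + \<bar>c\<bar>))"
          using L by (intro mult_mono) auto
        also have "\<dots> = d / 2"
          by (rule nonzero_mult_div_cancel_left[THEN trans[OF times_divide_eq_right]]) linarith
        finally show "\<bar>c\<bar> * dist (rvec e L) x \<le> d / 2" .
      qed
      finally show "\<exists>L. dist (rvec e L) (c *\<^sub>R x) < d" by auto
    qed
  qed
  moreover have "range e \<subseteq> S"
    using unit_rvec[of e] closure_subset unfolding S_def by (metis image_subset_iff rangeI subset_iff)
  ultimately have "span (range e) \<subseteq> S" by (metis span_minimal)
  then have "closure (span (range e)) \<subseteq> S"
    by (simp add: S_def closure_minimal)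
  then have "x \<in> S" using assms(1) by auto
  then show ?thesis using \<open>0 < d\<close> unfolding cl by blast
qed

section \<open>Names of points, functions and sequences\<close>

lemma cauchy_rep_iff:
  "cauchy_rep e p = Some x \<longleftrightarrow> (\<forall>k. dist (ratcomb e (p k)) x \<le> inverse (2 ^ k))"
proof -
  have uniq: "x = y" if "\<forall>k. dist (ratcomb e (p k)) x \<le> inverse (2 ^ k)"
      "\<forall>k. dist (ratcomb e (p k)) y \<le> inverse (2 ^ k)" for x y
  proof -
    have lim: "(\<lambda>k. inverse (2 ^ k) :: real) \<longlonglongrightarrow> 0"
      using LIMSEQ_inverse_realpow_zero[of 2] by simp
    have "(\<lambda>k. ratcomb e (p k)) \<longlonglongrightarrow> z" if "\<forall>k. dist (ratcomb e (p k)) z \<le> inverse (2 ^ k)" for z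
      unfolding tendsto_dist_iff[of _ z]
      by (rule tendsto_sandwich[OF _ _ tendsto_const lim]) (use that in auto)
    from LIMSEQ_unique[OF this[OF that(1)] this[OF that(2)]] show ?thesis .
  qed
  show ?thesis
  proof (cases "\<exists>y. \<forall>k. dist (ratcomb e (p k)) y \<le> inverse (2 ^ k)")
    case True
    then obtain y where y: "\<forall>k. dist (ratcomb e (p k)) y \<le> inverse (2 ^ k)" by blast
    then have "(THE y. \<forall>k. dist (ratcomb e (p k)) y \<le> inverse (2 ^ k)) = y"
      by (rule the_equality) (rule uniq[OF _ y])
    then have "cauchy_rep e p = Some y"
      unfolding cauchy_rep_def using True by (simp only: if_True)
    then have "cauchy_rep e p = Some x \<longleftrightarrow> y = x" by simp
    then show ?thesis using uniq[OF y, of x] y by blast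
  next
    case False
    then show ?thesis unfolding cauchy_rep_def by (simp only: if_False) blast
  qed
qed

lemma cauchy_rep_surj:
  assumes "closure (span (range e)) = UNIV"
  shows "\<exists>p. cauchy_rep e p = Some x"
proof -
  have "\<forall>k. \<exists>L. dist (rvec e L) x < inverse (2 ^ k)"
    using rvec_dense[OF assms] by simp
  then obtain L where "\<And>k. dist (rvec e (L k)) x < inverse (2 ^ k)" by metis
  then show ?thesis unfolding cauchy_rep_iff by (intro exI[of _ "\<lambda>k. enc (L k)"]) (simp add: less_imp_le)
qed

text \<open>As every point has a name, the values of T can be read off the associate, so at most one
  T fits and the definite description denotes it.\<close>

lemma fun_rep_iff:
  fixes dX :: "'a::topological_space rep" and dY :: "'b::topological_space rep"
  assumes surj: "\<And>x. \<exists>p. dX p = Some x"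
  shows "fun_rep dX dY q = Some T \<longleftrightarrow> continuous_on UNIV T \<and>
    (\<forall>p x. dX p = Some x \<longrightarrow> (\<exists>r. eta q p = Some r \<and> dY r = Some (T x)))" (is "_ \<longleftrightarrow> ?P T")
proof -
  have uniq: "T = T'" if "?P T" "?P T'" for T T'
  proof
    fix x
    obtain p where "dX p = Some x" using surj by blast
    with that show "T x = T' x" by force
  qed
  show ?thesis
  proof (cases "\<exists>T. ?P T")
    case True
    then obtain T' where T': "?P T'" by blast
    then have "(THE T. ?P T) = T'" by (intro the_equality uniq)
    moreover have "fun_rep dX dY q = Some (THE T. ?P T)"
      unfolding fun_rep_def Let_def using True by (rule if_P)
    ultimately have "fun_rep dX dY q = Some T \<longleftrightarrow> T' = T" by simp
    then show ?thesis using uniq[OF T', of T] T' by blast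
  next
    case False
    then have "fun_rep dX dY q = None"
      unfolding fun_rep_def Let_def by (rule if_not_P)
    then show ?thesis using False by auto
  qed
qed

lemma seq_rep_iff: "seq_rep d p = Some T \<longleftrightarrow> (\<forall>i. d (\<lambda>n. p (prod_encode (i, n))) = Some (T i))"
  unfolding seq_rep_def by (auto intro!: ext) (metis option.distinct(1))

text \<open>The norm is the distance to the combination with code 0. Scaling by \<open>2 ^ m\<close>
  and rounding down gives a natural number, so later comparisons use natural arithmetic only. The
  error 2 is 1 from the rational approximation plus 1 from rounding.\<close>

lemma computable_norm_approx:
  fixes e :: "nat \<Rightarrow> 'a::banach"
  assumes "computable_banach e"
  obtains B :: "nat \<Rightarrow> nat \<Rightarrow> nat"
  where "computable (\<lambda>y. B (fst y) (snd y))"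
    and "\<And>j m. \<bar>2 ^ m * norm (ratcomb e j) - real (B j m)\<bar> \<le> 2"
proof -
  obtain r where r: "recursive r"
    and r_approx: "\<And>n k. \<bar>(case prod_decode n of (i, j) \<Rightarrow> dist (ratcomb e i) (ratcomb e j))
      - rat_dec (r (prod_encode (n, k)))\<bar> \<le> inverse (2 ^ k)"
    using assms unfolding computable_banach_def computable_real_seq_def by blast
  define R :: "nat \<Rightarrow> nat \<Rightarrow> int \<times> nat" where "R j m = dec (r (prod_encode (prod_encode (j, 0), m)))" for j m
  define B where "B j m = nat (fst (R j m)) * 2 ^ m div Suc (snd (R j m))" for j m
  have "computable (\<lambda>y::nat \<times> nat. R (fst y) (snd y))"
    unfolding R_def by (intro comp_intro computable_comp[OF computable_of_recursive[OF r]])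
  then have "computable (\<lambda>y. B (fst y) (snd y))"
    unfolding B_def by (intro comp_intro)
  moreover have "\<bar>2 ^ m * norm (ratcomb e j) - real (B j m)\<bar> \<le> 2" for j m
  proof -
    define \<rho> where "\<rho> = real (nat (fst (R j m))) / real (Suc (snd (R j m)))"
    have "\<bar>norm (ratcomb e j) - q2r (R j m)\<bar> \<le> inverse (2 ^ m)"
      using r_approx[of "prod_encode (j, 0)" m] by (simp add: R_def rat_dec_q2r ratcomb_0)
    \<comment> \<open>Cutting the rational off at 0 brings it no further from the norm, which is
      nonnegative.\<close>
    moreover have "\<rho> = max 0 (q2r (R j m))"
      unfolding \<rho>_def q2r_def by (cases "fst (R j m) \<ge> 0") (auto simp: max_def divide_nonpos_pos zero_le_divide_iff)
    ultimately have 1: "\<bar>norm (ratcomb e j) - \<rho>\<bar> \<le> inverse (2 ^ m)"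
      using norm_ge_zero[of "ratcomb e j"] by linarith
    have "\<bar>2 ^ m * (norm (ratcomb e j) - \<rho>)\<bar> \<le> 1"
      using mult_left_mono[OF 1, of "2 ^ m"] by (simp add: abs_mult)
    moreover have "2 ^ m * \<rho> = real (nat (fst (R j m)) * 2 ^ m) / real (Suc (snd (R j m)))"
      unfolding \<rho>_def by simp
    then have "real (B j m) = of_int \<lfloor>2 ^ m * \<rho>\<rfloor>"
      unfolding B_def by (simp only: floor_divide_of_nat_eq of_int_of_nat_eq)
    then have "\<bar>2 ^ m * \<rho> - real (B j m)\<bar> \<le> 1" by linarith
    ultimately show ?thesis by (simp add: right_diff_distrib)
  qed
  ultimately show thesis by (rule that)
qed

section \<open>The reduction to closed choice\<close>

text \<open>By Baire's theorem one of the closed sets \<open>F n\<close>, which cover the space,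
  contains a ball; linearity carries the bound on the ball to the whole space.\<close>

lemma uniform_boundedness:
  fixes T :: "nat \<Rightarrow> 'a::banach \<Rightarrow> 'b::real_normed_vector"
  assumes T: "\<And>i. bounded_linear (T i)" and bdd: "\<And>x. bounded (range (\<lambda>i. norm (T i x)))"
  shows "\<exists>M::nat. \<forall>i. onorm (T i) \<le> real M"
proof -
  define F where "F n = {x. \<forall>i. norm (T i x) \<le> real n}" for n :: nat
  have clF: "closed (F n)" for n
    unfolding F_def using linear_continuous_on[OF T]
    by (intro closed_Collect_all closed_Collect_le continuous_on_norm continuous_on_const)
  have "x \<in> \<Union> (range F)" for x
  proof -
    obtain b where b: "\<And>i. norm (norm (T i x)) \<le> b"
      using bdd[of x] unfolding bounded_iff by auto
    obtain n :: nat where "b \<le> real n" using real_arch_simple by blast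
    with b have "x \<in> F n" unfolding F_def by (auto intro: order_trans)
    then show ?thesis by blast
  qed
  then have "\<Union> (range F) = UNIV" by blast
  then have "interior (\<Union> (range F)) = UNIV" by simp
  then have "\<exists>n. interior (F n) \<noteq> {}"
    using Met_TC.metric_Baire_category_alt[of "range F"] clF complete_UNIV by auto
  then obtain n x0 r where "0 < r" and r: "ball x0 r \<subseteq> F n"
    by (metis ex_in_conv mem_interior)
  have "norm (T i x) \<le> 4 * real n / r * norm x" for i x
  proof (cases "x = 0")
    case True
    then show ?thesis using linear_simps(3)[OF T] by simp
  next
    case False
    interpret bounded_linear "T i" by (rule T)
    \<comment> \<open>With this factor \<open>x0 + c *\<^sub>R x\<close> is at distance r / 2 from
      the centre, hence in the ball.\<close>
    define c where "c = r / (2 * norm x)"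
    have c: "0 < c" using False \<open>0 < r\<close> by (simp add: c_def)
    have "x0 + c *\<^sub>R x \<in> ball x0 r" "x0 \<in> ball x0 r"
      using False \<open>0 < r\<close> by (simp_all add: dist_norm c_def)
    then have "norm (T i (x0 + c *\<^sub>R x)) \<le> n" "norm (T i x0) \<le> n"
      using r unfolding F_def by blast+
    then have "norm (T i (x0 + c *\<^sub>R x) - T i x0) \<le> 2 * real n"
      using norm_triangle_ineq4[of "T i (x0 + c *\<^sub>R x)" "T i x0"] by linarith
    then have "c * norm (T i x) \<le> 2 * real n"
      using c by (simp add: add scaleR)
    then show ?thesis
      using False \<open>0 < r\<close> by (simp add: c_def field_simps)
  qed
  moreover obtain M :: nat where "4 * real n / r \<le> real M" using real_arch_simple by blast
  moreover have "0 \<le> 4 * real n / r" using \<open>0 < r\<close> by simp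
  ultimately show ?thesis
    by (meson onorm_bound order_trans)
qed

text \<open>Each digit is tied to finitely many values of q: zeros up to the first positive answer.
  This is what a finite certificate can check.\<close>

lemma eta_eq_Some_iff:
  "eta q p = Some r \<longleftrightarrow> (\<forall>n. \<exists>k. 0 < q (prod_encode (n, prefix_code p k)) \<and>
     (\<forall>k'<k. q (prod_encode (n, prefix_code p k')) = 0) \<and>
     r n = q (prod_encode (n, prefix_code p k)) - 1)" (is "_ = ?R")
proof
  assume "eta q p = Some r"
  then have ex: "\<And>n. \<exists>k. 0 < q (prod_encode (n, prefix_code p k))"
    and r: "r = (\<lambda>n. q (prod_encode (n, prefix_code p
                     (LEAST k. 0 < q (prod_encode (n, prefix_code p k))))) - 1)"
    unfolding eta_def by (auto split: if_splits)
  show ?R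
  proof
    fix n
    define k where "k = (LEAST k. 0 < q (prod_encode (n, prefix_code p k)))"
    have "0 < q (prod_encode (n, prefix_code p k))"
      unfolding k_def by (rule LeastI_ex[OF ex])
    moreover have "\<forall>k'<k. q (prod_encode (n, prefix_code p k')) = 0"
      unfolding k_def using not_less_Least by blast
    moreover have "r n = q (prod_encode (n, prefix_code p k)) - 1"
      by (simp add: r k_def)
    ultimately show "\<exists>k. 0 < q (prod_encode (n, prefix_code p k)) \<and>
     (\<forall>k'<k. q (prod_encode (n, prefix_code p k')) = 0) \<and>
     r n = q (prod_encode (n, prefix_code p k)) - 1" by blast
  qed
next
  assume R: ?R
  have "r n = q (prod_encode (n, prefix_code p (LEAST k. 0 < q (prod_encode (n, prefix_code p k))))) - 1" for n
  proof -
    from R obtain k where k: "0 < q (prod_encode (n, prefix_code p k))"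
      "\<forall>k'<k. q (prod_encode (n, prefix_code p k')) = 0"
      "r n = q (prod_encode (n, prefix_code p k)) - 1" by blast
    have "(LEAST k. 0 < q (prod_encode (n, prefix_code p k))) = k"
      using k(1,2) by (intro Least_equality) (auto simp: not_less[symmetric])
    with k(3) show ?thesis by simp
  qed
  then show "eta q p = Some r" using R unfolding eta_def by auto
qed

text \<open>The position, in a name of \<^term>\<open>(T i)\<close>, of the answer of the associate of \<^term>\<open>T i\<close> for output
  digit \<^term>\<open>m\<close> after \<^term>\<open>k\<close> entries of the constant name \<^term>\<open>\<lambda>_. j\<close>.\<close>

definition query :: "nat \<Rightarrow> nat \<Rightarrow> nat \<Rightarrow> nat \<Rightarrow> nat" where
  "query i j m k = prod_encode (i, prod_encode (m, enc (map (\<lambda>_. j) [0..<k])))"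

lemma prefix_code_enc: "prefix_code p k = enc (map p [0..<k])"
  by (simp add: prefix_code_def enc_list_def comp_def enc_nat_def)

type_synonym cert = "nat \<times> nat \<times> nat \<times> nat \<times> nat \<times> nat"

text \<open>The last component of a certificate is padding: it makes the code of the certificate larger
  than all queried positions, so that digit \<^term>\<open>n\<close> of the output depends only on the first
  \<^term>\<open>n\<close> digits of the input.\<close>

definition certifies :: "(nat \<Rightarrow> nat \<Rightarrow> nat) \<Rightarrow> (nat \<Rightarrow> nat \<Rightarrow> nat) \<Rightarrow> cert \<Rightarrow> nat list \<Rightarrow> bool" where
  "certifies BX BY c w \<longleftrightarrow> (case c of (M, i, j, m, k, l) \<Rightarrow>
     (\<forall>k'<Suc k. query i j m k' < length w) \<and>
     (\<forall>k'<k. nth_code w (query i j m k') = 0) \<and>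
     0 < nth_code w (query i j m k) \<and>
     M * (BX j m + 2) + 3 < BY (nth_code w (query i j m k) - 1) m)"

lemma computable_query [comp_intro]:
  assumes "computable a" "computable b" "computable c" "computable d"
  shows "computable (\<lambda>x. query (a x) (b x) (c x) (d x))"
proof -
  have "computable (\<lambda>y. query (fst y) (fst (snd y)) (fst (snd (snd y))) (snd (snd (snd y))))"
    unfolding query_def by (intro comp_intro)
  from computable_comp[OF this, of "\<lambda>x. (a x, b x, c x, d x)"] show ?thesis
    using assms by (simp add: comp_intro)
qed

lemma decidable_certifies:
  assumes BX: "computable (\<lambda>y. BX (fst y) (snd y))" and BY: "computable (\<lambda>y. BY (fst y) (snd y))"
  shows "decidable (\<lambda>y. certifies BX BY (fst y) (snd y))"
  unfolding certifies_def case_prod_unfold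
  by (intro comp_intro computable_comp2[OF BX] computable_comp2[OF BY])

text \<open>The first positive answer on the constant name determines digit m of a name of the
  image. In the test, 2 covers the error of \<open>BX\<close>, and 3 is the error 2 of
  \<open>BY\<close> plus the error \<open>2 ^ m * inverse (2 ^ m)\<close> of the digit.\<close>

lemma certifies_sound:
  fixes eX :: "nat \<Rightarrow> 'x::banach" and eY :: "nat \<Rightarrow> 'y::banach"
  assumes BX: "\<And>j m. \<bar>2 ^ m * norm (ratcomb eX j) - real (BX j m)\<bar> \<le> 2"
    and BY: "\<And>j m. \<bar>2 ^ m * norm (ratcomb eY j) - real (BY j m)\<bar> \<le> 2"
    and eta: "eta (\<lambda>n. p (prod_encode (i, n))) (\<lambda>_. j) = Some r"
    and r: "cauchy_rep eY r = Some (T (ratcomb eX j))"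
    and T: "bounded_linear T"
    and cert: "certifies BX BY (M, i, j, m, k, l) (map p [0..<n])"
  shows "real M < onorm T"
proof -
  have w: "nth_code (map p [0..<n]) (query i j m k') = p (query i j m k')" "query i j m k' < n" if "k' \<le> k" for k'
    using that cert unfolding certifies_def by (auto simp: less_Suc_eq_le)
  have "(\<forall>k'<k. p (query i j m k') = 0)" "0 < p (query i j m k)"
    and le: "M * (BX j m + 2) + 3 < BY (p (query i j m k) - 1) m"
    using cert w unfolding certifies_def by auto
  moreover obtain k0 where "0 < p (query i j m k0)" "\<forall>k'<k0. p (query i j m k') = 0"
    and "r m = p (query i j m k0) - 1"
    using eta[unfolded eta_eq_Some_iff, rule_format, of m] unfolding query_def prefix_code_enc by blast
  ultimately have rm: "r m = p (query i j m k) - 1"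
    by (metis linorder_neqE_nat not_gr_zero)
  let ?x = "ratcomb eX j" and ?y = "ratcomb eY (r m)"
  have "dist ?y (T ?x) \<le> inverse (2 ^ m)"
    using r unfolding cauchy_rep_iff by blast
  then have "norm ?y \<le> norm (T ?x) + inverse (2 ^ m)"
    using norm_triangle_ineq2[of ?y "T ?x"] by (simp add: dist_norm)
  then have "2 ^ m * norm ?y \<le> 2 ^ m * (norm (T ?x) + inverse (2 ^ m))"
    by (intro mult_left_mono) auto
  then have 1: "2 ^ m * norm ?y \<le> 2 ^ m * norm (T ?x) + 1"
    by (simp add: distrib_left)
  have "real (M * (BX j m + 2) + 3) < real (BY (r m) m)"
    using le rm by (simp only: of_nat_less_iff)
  then have 2: "real M * (real (BX j m) + 2) + 3 < real (BY (r m) m)"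
    by (simp add: algebra_simps)
  have "real M * (2 ^ m * norm ?x) \<le> real M * (real (BX j m) + 2)"
    using BX[where j=j and m=m] by (intro mult_left_mono) linarith+
  with 1 2 BY[where j="r m" and m=m] have "real M * (2 ^ m * norm ?x) < 2 ^ m * norm (T ?x)"
    by linarith
  then have "2 ^ m * (real M * norm ?x) < 2 ^ m * norm (T ?x)"
    by (simp only: mult.left_commute)
  then have *: "real M * norm ?x < norm (T ?x)"
    by simp
  show ?thesis
  proof (rule ccontr)
    assume "\<not> real M < onorm T"
    then have "norm (T ?x) \<le> real M * norm ?x"
      using onorm[OF T, of ?x] mult_right_mono[of "onorm T" "real M" "norm ?x"] by simp
    with * show False by simp
  qed
qed

text \<open>The strict inequality between \<open>real M * norm x\<close> and
  \<open>norm (T x)\<close> is an open condition on x, so it holds at some rational combination. All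
  sufficiently large paddings and prefixes work.\<close>

lemma certifies_complete:
  fixes eX :: "nat \<Rightarrow> 'x::banach" and eY :: "nat \<Rightarrow> 'y::banach"
  assumes dense: "closure (span (range eX)) = UNIV"
    and BX: "\<And>j m. \<bar>2 ^ m * norm (ratcomb eX j) - real (BX j m)\<bar> \<le> 2"
    and BY: "\<And>j m. \<bar>2 ^ m * norm (ratcomb eY j) - real (BY j m)\<bar> \<le> 2"
    and rep: "\<And>j. \<exists>r. eta (\<lambda>n. p (prod_encode (i, n))) (\<lambda>_. j) = Some r \<and>
      cauchy_rep eY r = Some (T (ratcomb eX j))"
    and T: "bounded_linear T" and M: "real M < onorm T"
  shows "\<exists>j m k. \<exists>l0. \<forall>l\<ge>l0. \<forall>n\<ge>l. certifies BX BY (M, i, j, m, k, l) (map p [0..<n])"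
proof -
  have "\<exists>x. real M * norm x < norm (T x)"
    using M onorm_bound[of "real M" T] by (metis not_le of_nat_0_le_iff)
  then obtain x0 where "x0 \<in> {x. real M * norm x < norm (T x)}" by blast
  moreover have "open {x. real M * norm x < norm (T x)}"
    by (intro open_Collect_less continuous_intros linear_continuous_on[OF T])
  ultimately obtain d where "0 < d" and d: "\<And>x. dist x x0 < d \<Longrightarrow> real M * norm x < norm (T x)"
    unfolding open_dist by blast
  obtain j where j: "real M * norm (ratcomb eX j) < norm (T (ratcomb eX j))"
    using rvec_dense[OF dense \<open>0 < d\<close>, of x0] d by blast
  let ?x = "ratcomb eX j"
  \<comment> \<open>After scaling, the approximations lose at most 4 M on one side, from
    \<open>BX\<close> and the added 2. The remaining 6 is the constant 3 of the test plus 3 for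
    \<open>BY\<close> and the digit.\<close>
  obtain m where m: "(4 * real M + 6) / (norm (T ?x) - real M * norm ?x) < 2 ^ m"
    using real_arch_pow[of 2] by auto
  then have m: "4 * real M + 6 < 2 ^ m * (norm (T ?x) - real M * norm ?x)"
    using j by (simp add: pos_divide_less_eq)
  obtain r where r: "eta (\<lambda>n. p (prod_encode (i, n))) (\<lambda>_. j) = Some r" "cauchy_rep eY r = Some (T ?x)"
    using rep by blast
  obtain k where k: "0 < p (query i j m k)" "\<forall>k'<k. p (query i j m k') = 0"
    and rm: "r m = p (query i j m k) - 1"
    using r(1)[unfolded eta_eq_Some_iff, rule_format, of m] unfolding query_def prefix_code_enc by blast
  let ?y = "ratcomb eY (r m)"
  have "dist ?y (T ?x) \<le> inverse (2 ^ m)"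
    using r(2) unfolding cauchy_rep_iff by blast
  then have "norm (T ?x) - inverse (2 ^ m) \<le> norm ?y"
    using norm_triangle_ineq2[of "T ?x" ?y] by (simp add: dist_norm norm_minus_commute)
  then have "2 ^ m * (norm (T ?x) - inverse (2 ^ m)) \<le> 2 ^ m * norm ?y"
    by (intro mult_left_mono) auto
  then have 1: "2 ^ m * norm (T ?x) - 1 \<le> 2 ^ m * norm ?y"
    by (simp add: right_diff_distrib)
  have "real M * real (BX j m) \<le> real M * (2 ^ m * norm ?x + 2)"
    using BX[where j=j and m=m] by (intro mult_left_mono) linarith+
  with 1 m BY[where j="r m" and m=m]
  have "real (M * (BX j m + 2) + 3) < real (BY (r m) m)"
    by (simp add: algebra_simps)
  then have le: "M * (BX j m + 2) + 3 < BY (p (query i j m k) - 1) m"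
    unfolding rm by (simp only: of_nat_less_iff)
  define l0 where "l0 = Suc (Max (query i j m ` {..k}))"
  have l0: "query i j m k' < l0" if "k' \<le> k" for k'
    unfolding l0_def using that by (simp add: less_Suc_eq_le)
  have "certifies BX BY (M, i, j, m, k, l) (map p [0..<n])" if "l0 \<le> l" "l \<le> n" for l n
  proof -
    have "query i j m k' < n" if "k' \<le> k" for k'
      using l0[OF that] \<open>l0 \<le> l\<close> \<open>l \<le> n\<close> by simp
    then show ?thesis using k le unfolding certifies_def by (auto simp: less_Suc_eq_le)
  qed
  then show ?thesis by blast
qed

text \<open>K checks every number n as a possible certificate and enumerates its M on success, which
  gives a negative name of \<open>UBT_map T\<close>. Choice from this set is already a
  solution.\<close>

lemma UBT_le_CN:
  fixes eX :: "nat \<Rightarrow> 'x::banach" and eY :: "nat \<Rightarrow> 'y::banach"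
  assumes "computable_banach eX" and "computable_banach eY"
  shows "W_le (seq_rep (fun_rep (cauchy_rep eX) (cauchy_rep eY))) nat_rep
      (UBT_dom :: (nat \<Rightarrow> ('x \<Rightarrow> 'y)) set) UBT_map neg_rep nat_rep CN_dom CN_map"
proof -
  obtain BX where BX: "computable (\<lambda>y. BX (fst y) (snd y))"
    "\<And>j m. \<bar>2 ^ m * norm (ratcomb eX j) - real (BX j m)\<bar> \<le> 2"
    using computable_norm_approx[OF assms(1)] by blast
  obtain BY where BY: "computable (\<lambda>y. BY (fst y) (snd y))"
    "\<And>j m. \<bar>2 ^ m * norm (ratcomb eY j) - real (BY j m)\<bar> \<le> 2"
    using computable_norm_approx[OF assms(2)] by blast
  have dense: "closure (span (range eX)) = UNIV"
    using assms(1) unfolding computable_banach_def by blast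
  \<comment> \<open>A failed check yields 0, the digit that enumerates nothing.\<close>
  define out where "out n w = (if certifies BX BY (dec n) w then Suc (fst (dec n :: cert)) else 0)" for n w
  define K where "K p = Some (\<lambda>n. out n (map p [0..<n]))" for p :: baire
  \<comment> \<open>The answer of G occupies the odd positions of the pair.\<close>
  define H where "H p = Some (\<lambda>n. p (2 * n + 1))" for p :: baire
  \<comment> \<open>Digit n depends on exactly the first n input digits, so only prefixes of that
    length receive a positive answer.\<close>
  have "computable_partial K"
  proof (rule computable_partialI[where g = "\<lambda>n w. if length w = n then Suc (out n w) else 0"])
    show "computable (\<lambda>y. if length (snd y) = fst y then Suc (out (fst y) (snd y)) else 0)"
      unfolding out_def
      by (intro comp_intro decidable_comp[OF decidable_certifies[OF BX(1) BY(1)],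
          of "\<lambda>y. (dec (fst y), snd y)", simplified])
  qed (auto simp: K_def split: if_splits)
  moreover have "computable_partial H"
  proof (rule computable_partialI[where g = "\<lambda>n w. if 2 * n + 1 < length w then Suc (nth_code w (2 * n + 1)) else 0"])
    show "computable (\<lambda>y. if 2 * fst y + 1 < length (snd y) then Suc (nth_code (snd y) (2 * fst y + 1)) else 0)"
      by (intro comp_intro)
    show "\<exists>k. 0 < (if 2 * n + 1 < length (map p [0..<k]) then Suc (nth_code (map p [0..<k]) (2 * n + 1)) else 0)"
      for n p by (rule exI[of _ "2 * n + 2"]) simp
  qed (auto simp: H_def split: if_splits)
  moreover have "realizer (seq_rep (fun_rep (cauchy_rep eX) (cauchy_rep eY))) nat_rep
      (UBT_dom :: (nat \<Rightarrow> ('x \<Rightarrow> 'y)) set) UBT_map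
      (\<lambda>p. case K p of None \<Rightarrow> None
         | Some r \<Rightarrow> (case G r of None \<Rightarrow> None | Some s \<Rightarrow> H (bpair p s)))"
    if G: "realizer neg_rep nat_rep CN_dom CN_map G" for G
    unfolding realizer_def
  proof (intro allI impI, elim conjE)
    fix p and T :: "nat \<Rightarrow> 'x \<Rightarrow> 'y"
    assume p: "seq_rep (fun_rep (cauchy_rep eX) (cauchy_rep eY)) p = Some T" and T: "T \<in> UBT_dom"
    have bl: "bounded_linear (T i)" for i using T unfolding UBT_dom_def by blast
    have rep: "\<exists>r. eta (\<lambda>n. p (prod_encode (i, n))) (\<lambda>_. j) = Some r \<and>
        cauchy_rep eY r = Some (T i (ratcomb eX j))" for i j
    proof -
      have "cauchy_rep eX (\<lambda>_. j) = Some (ratcomb eX j)"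
        unfolding cauchy_rep_iff by simp
      then show ?thesis
        using p unfolding seq_rep_iff fun_rep_iff[OF cauchy_rep_surj[OF dense]] by blast
    qed
    define r where "r n = out n (map p [0..<n])" for n
    have "Suc M \<in> range r \<longleftrightarrow> (\<exists>i. real M < onorm (T i))" for M
    proof
      assume "Suc M \<in> range r"
      then obtain n where n: "r n = Suc M" by (metis rangeE)
      obtain M' i j m k l where d: "(dec n :: cert) = (M', i, j, m, k, l)"
        by (metis prod.exhaust)
      have "certifies BX BY (M, i, j, m, k, l) (map p [0..<n])"
        using n unfolding r_def out_def d by (auto split: if_splits)
      moreover obtain u where "eta (\<lambda>n. p (prod_encode (i, n))) (\<lambda>_. j) = Some u"
          "cauchy_rep eY u = Some (T i (ratcomb eX j))"
        using rep by blast
      ultimately show "\<exists>i. real M < onorm (T i)"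
        using certifies_sound[OF BX(2) BY(2) _ _ bl] by blast
    next
      assume "\<exists>i. real M < onorm (T i)"
      then obtain i j m k l where l: "\<And>n. l \<le> n \<Longrightarrow> certifies BX BY (M, i, j, m, k, l) (map p [0..<n])"
        using certifies_complete[OF dense BX(2) BY(2) rep bl] by (metis order_refl)
      \<comment> \<open>The code of the certificate is at least its component l, so the first n
        digits contain all queried positions.\<close>
      define n where "n = enc (M, i, j, m, k, l)"
      have "l \<le> n"
        unfolding n_def enc_prod_def fst_conv snd_conv enc_nat_def
        by (meson le_prod_encode_2 order_trans)
      then have "r n = Suc M"
        using l[of n] unfolding r_def out_def by (simp add: n_def)
      then show "Suc M \<in> range r" by (metis rangeI)
    qed
    then have "{n. Suc n \<notin> range r} = UBT_map T"
      unfolding UBT_map_def by (auto simp: not_less)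
    then have "neg_rep r = Some (UBT_map T)"
      unfolding neg_rep_def by simp
    moreover have "UBT_map T \<noteq> {}"
      using uniform_boundedness[of T] T unfolding UBT_map_def UBT_dom_def by blast
    ultimately obtain s where s: "G r = Some s" "s 0 \<in> UBT_map T"
      using G unfolding realizer_def CN_dom_def CN_map_def nat_rep_def by (metis (mono_tags) mem_Collect_eq option.inject)
    have "K p = Some r" unfolding K_def r_def ..
    moreover have "H (bpair p s) = Some s"
      unfolding H_def bpair_def by simp
    ultimately show "\<exists>q y. (case K p of None \<Rightarrow> None
         | Some r \<Rightarrow> (case G r of None \<Rightarrow> None | Some s \<Rightarrow> H (bpair p s))) = Some q \<and>
        nat_rep q = Some y \<and> y \<in> UBT_map T"
      using s by (simp add: nat_rep_def)
  qed
  ultimately show ?thesis unfolding W_le_def by blast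
qed

section \<open>Smooth points of the norm\<close>

text \<open>By convexity, \<open>second_diff z x t / t\<close> decreases, as t decreases to 0, to
  the gap between the right and left derivatives of the norm at z along x. A small value for one t
  therefore bounds the gap.\<close>

definition second_diff :: "'a::real_normed_vector \<Rightarrow> 'a \<Rightarrow> real \<Rightarrow> real" where
  "second_diff z x t = norm (z + t *\<^sub>R x) + norm (z - t *\<^sub>R x) - 2 * norm z"

text \<open>Three norms, one of them with weight two, each change by at most the displacement. This
  carries flatness from an approximation to the limit point.\<close>

lemma second_diff_lipschitz: "second_diff z x t \<le> second_diff y x t + 4 * norm (z - y)"
proof -
  have "norm (z + t *\<^sub>R x) \<le> norm (y + t *\<^sub>R x) + norm (z - y)"
    using norm_triangle_ineq[of "y + t *\<^sub>R x" "z - y"] by (simp add: add.commute)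
  moreover have "norm (z - t *\<^sub>R x) \<le> norm (y - t *\<^sub>R x) + norm (z - y)"
    using norm_triangle_ineq[of "y - t *\<^sub>R x" "z - y"] by simp
  moreover have "norm y \<le> norm z + norm (z - y)"
    using norm_triangle_ineq[of z "y - z"] by (simp add: norm_minus_commute)
  ultimately show ?thesis unfolding second_diff_def by linarith
qed

text \<open>Along a line the second differences of the norm telescope to a sum of size at most
  \<^term>\<open>2 * t * norm x\<close>, so one of many of them is small.\<close>

lemma second_diff_small_nearby:
  fixes z x :: "'a::real_normed_vector" and d \<epsilon> :: real
  assumes "0 < d" "0 < \<epsilon>"
  shows "\<exists>a l. norm ((real l / 2 ^ a) *\<^sub>R x) < d \<and>
     second_diff (z + (real l / 2 ^ a) *\<^sub>R x) x (1 / 2 ^ a) < \<epsilon> / 2 ^ a"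
proof -
  \<comment> \<open>J terms of size at least \<open>\<epsilon> * t\<close> would exceed the
    telescoped bound \<open>2 * t * norm x\<close>. The step is then taken so fine that all J grid
    points stay within d.\<close>
  obtain J :: nat where J: "2 * norm x / \<epsilon> < real J"
    using reals_Archimedean2 by blast
  then have J: "2 * norm x < real J * \<epsilon>"
    using assms by (simp add: pos_divide_less_eq)
  obtain a where "real J * norm x / d < 2 ^ a"
    using real_arch_pow[of 2] by auto
  then have a: "real J * norm x < d * 2 ^ a"
    using assms by (simp add: pos_divide_less_eq mult.commute)
  define t :: real where "t = 1 / 2 ^ a"
  have t: "0 < t" by (simp add: t_def)
  define g where "g l = norm (z + (real l * t) *\<^sub>R x)" for l
  have sd: "second_diff (z + (real (Suc l) * t) *\<^sub>R x) x t = g (Suc (Suc l)) + g l - 2 * g (Suc l)" for l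
  proof -
    have "z + (real (Suc l) * t) *\<^sub>R x + t *\<^sub>R x = z + (real (Suc (Suc l)) * t) *\<^sub>R x"
      "z + (real (Suc l) * t) *\<^sub>R x - t *\<^sub>R x = z + (real l * t) *\<^sub>R x"
      by (simp_all add: distrib_right scaleR_add_left flip: scaleR_2)
    then show ?thesis unfolding second_diff_def g_def by (simp only:)
  qed
  have "\<exists>l<J. second_diff (z + (real (Suc l) * t) *\<^sub>R x) x t < \<epsilon> * t"
  proof (rule ccontr)
    assume "\<not> ?thesis"
    then have "(\<Sum>l<J. \<epsilon> * t) \<le> (\<Sum>l<J. g (Suc (Suc l)) + g l - 2 * g (Suc l))"
      unfolding sd by (intro sum_mono) auto
    also have "\<dots> = (g (Suc J) - g J) - (g 1 - g 0)"
      by (induction J) auto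
    also have "\<dots> \<le> 2 * (t * norm x)"
    proof -
      have g_mono: "\<bar>g (Suc l) - g l\<bar> \<le> t * norm x" for l
        using norm_triangle_ineq3[of "z + (real (Suc l) * t) *\<^sub>R x" "z + (real l * t) *\<^sub>R x"] t
        unfolding g_def by (simp add: algebra_simps)
      show ?thesis using g_mono[of J] g_mono[of 0] by (simp del: One_nat_def add: One_nat_def[symmetric])
    qed
    finally have "real J * \<epsilon> * t \<le> 2 * norm x * t" by (simp add: mult.assoc mult.commute[of t])
    then show False using J t by simp
  qed
  then obtain l where l: "l < J" "second_diff (z + (real (Suc l) * t) *\<^sub>R x) x t < \<epsilon> * t" by blast
  have "norm ((real (Suc l) * t) *\<^sub>R x) = real (Suc l) * norm x / 2 ^ a"
    by (simp add: t_def)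
  also have "\<dots> \<le> real J * norm x / 2 ^ a"
    using l by (intro divide_right_mono mult_right_mono) auto
  also have "\<dots> < d" using a by (simp add: pos_divide_less_eq)
  finally show ?thesis using l by (intro exI[of _ a] exI[of _ "Suc l"]) (simp add: t_def)
qed

text \<open>The right derivative f is an infimum of difference quotients, monotone by convexity, and
  is sublinear. Smoothness makes it odd on D, and density makes it odd everywhere, hence linear. The
  last two conclusions bracket f between one-sided quotients, so that it can be computed.\<close>

lemma norm_smooth_point_functional:
  fixes z :: "'a::real_normed_vector"
  assumes dense: "\<And>x d. 0 < d \<Longrightarrow> \<exists>y\<in>D. norm (x - y) < d"
    and smooth: "\<And>x \<epsilon>. x \<in> D \<Longrightarrow> 0 < \<epsilon> \<Longrightarrow> \<exists>t>0. second_diff z x t < \<epsilon> * t"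
  obtains f where "bounded_linear f" "\<And>x. \<bar>f x\<bar> \<le> norm x" "f z = norm z"
    "\<And>x t. 0 < t \<Longrightarrow> t * f x \<le> norm (z + t *\<^sub>R x) - norm z"
    "\<And>x t. 0 < t \<Longrightarrow> norm z - norm (z - t *\<^sub>R x) \<le> t * f x"
proof -
  define \<phi> where "\<phi> x t = (norm (z + t *\<^sub>R x) - norm z) / t" for x t
  define f where "f x = Inf (\<phi> x ` {0<..})" for x
  have lower: "- norm x \<le> \<phi> x t" and upper: "\<phi> x t \<le> norm x" if "0 < t" for x t
  proof -
    have "\<bar>norm (z + t *\<^sub>R x) - norm z\<bar> \<le> t * norm x"
      using norm_triangle_ineq3[of "z + t *\<^sub>R x" z] that by simp
    then show "- norm x \<le> \<phi> x t" "\<phi> x t \<le> norm x"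
      using that unfolding \<phi>_def by (simp_all add: pos_le_divide_eq pos_divide_le_eq abs_le_iff mult.commute)
  qed
  have bdd: "bdd_below (\<phi> x ` {0<..})" for x
    using lower by (intro bdd_belowI2[of _ "- norm x"]) auto
  have f_le: "f x \<le> \<phi> x t" if "0 < t" for x t
    unfolding f_def using that by (intro cINF_lower[OF bdd]) auto
  have le_f: "c \<le> f x" if "\<And>t. 0 < t \<Longrightarrow> c \<le> \<phi> x t" for c x
    unfolding f_def using that by (intro cINF_greatest) auto
  have mono: "\<phi> x s \<le> \<phi> x t" if "0 < s" "s \<le> t" for x s t
  proof -
    have "t *\<^sub>R (z + s *\<^sub>R x) = (t - s) *\<^sub>R z + s *\<^sub>R (z + t *\<^sub>R x)"
      by (simp add: algebra_simps)
    then have "norm (t *\<^sub>R (z + s *\<^sub>R x)) \<le> norm ((t - s) *\<^sub>R z) + norm (s *\<^sub>R (z + t *\<^sub>R x))"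
      by (simp only: norm_triangle_ineq)
    then have "t * norm (z + s *\<^sub>R x) \<le> (t - s) * norm z + s * norm (z + t *\<^sub>R x)"
      using that by simp
    then show ?thesis
      using that unfolding \<phi>_def by (simp add: divide_simps) (simp add: algebra_simps)
  qed
  have add_le: "f (x + y) \<le> f x + f y" for x y
  proof -
    have "f (x + y) - \<phi> y t \<le> \<phi> x s" if "0 < s" "0 < t" for s t
    proof -
      \<comment> \<open>Midpoint convexity compares step u for x + y with step 2 u for x and for y.
        Halving the minimum keeps 2 u below s and t, where monotonicity applies.\<close>
      define u where "u = min s t / 2"
      have u: "0 < u" "2 * u \<le> s" "2 * u \<le> t" using that by (auto simp: u_def)
      have "2 *\<^sub>R (z + u *\<^sub>R (x + y)) = (z + (2 * u) *\<^sub>R x) + (z + (2 * u) *\<^sub>R y)"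
        by (simp add: algebra_simps scaleR_2)
      then have "norm (2 *\<^sub>R (z + u *\<^sub>R (x + y))) \<le> norm (z + (2 * u) *\<^sub>R x) + norm (z + (2 * u) *\<^sub>R y)"
        by (simp only: norm_triangle_ineq)
      then have *: "2 * norm (z + u *\<^sub>R (x + y)) \<le> norm (z + (2 * u) *\<^sub>R x) + norm (z + (2 * u) *\<^sub>R y)"
        by simp
      then have "\<phi> (x + y) u \<le> \<phi> x (2 * u) + \<phi> y (2 * u)"
      proof -
        have "(b - n) / (2 * u) + (c - n) / (2 * u) - (a - n) / u = (b + c - 2 * a) / (2 * u)" for a b c n
          using u by (simp add: field_simps)
        moreover have "0 \<le> (b + c - 2 * a) / (2 * u)" if "2 * a \<le> b + c" for a b c
          using that u by simp
        ultimately have "(a - n) / u \<le> (b - n) / (2 * u) + (c - n) / (2 * u)" if "2 * a \<le> b + c" for a b c n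
          using that by (metis diff_ge_0_iff_ge)
        with * show ?thesis unfolding \<phi>_def by blast
      qed
      with f_le[of u "x + y"] mono[of "2 * u" s x] mono[of "2 * u" t y] u show ?thesis by simp
    qed
    then have "f (x + y) - \<phi> y t \<le> f x" if "0 < t" for t
      using that by (intro le_f)
    then have "f (x + y) - f x \<le> f y"
      by (intro le_f) (simp add: algebra_simps)
    then show ?thesis by simp
  qed
  have f_0: "f 0 = 0"
    using f_le[of 1 0] le_f[of 0 0] by (simp add: \<phi>_def)
  have f_le_norm: "f x \<le> norm x" for x
    using f_le[of 1 x] upper[of 1 x] by simp
  have f_scale: "f (c *\<^sub>R x) = c * f x" if "0 < c" for c x
  proof -
    have le: "c * f x \<le> f (c *\<^sub>R x)" if "0 < c" for c x
    proof (rule le_f)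
      fix t :: real assume "0 < t"
      then have "\<phi> (c *\<^sub>R x) t = c * \<phi> x (t * c)" using \<open>0 < c\<close> by (simp add: \<phi>_def)
      then show "c * f x \<le> \<phi> (c *\<^sub>R x) t"
        using f_le[of "t * c" x] \<open>0 < t\<close> \<open>0 < c\<close> by simp
    qed
    have "inverse c * f (c *\<^sub>R x) \<le> f x"
      using le[of "inverse c" "c *\<^sub>R x"] that by simp
    then have "f (c *\<^sub>R x) \<le> c * f x" using that by (simp add: field_simps)
    with le[OF that] show ?thesis by (simp add: antisym)
  qed
  \<comment> \<open>The sum is the gap between right and left derivatives, which a single quotient
    \<open>second_diff z x t / t\<close> bounds.\<close>
  have sym_D: "f x + f (- x) \<le> 0" if x: "x \<in> D" for x
  proof (rule field_le_epsilon)
    fix \<epsilon> :: real assume "0 < \<epsilon>"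
    then obtain t where t: "0 < t" "second_diff z x t < \<epsilon> * t" using smooth[OF x] by blast
    have "f x + f (- x) \<le> \<phi> x t + \<phi> (- x) t" using f_le t(1) by (simp add: add_mono)
    also have "\<dots> = second_diff z x t / t"
      unfolding \<phi>_def second_diff_def using t(1) by (simp add: field_simps)
    also have "\<dots> \<le> \<epsilon>" using t by (simp add: pos_divide_le_eq)
    finally show "f x + f (- x) \<le> 0 + \<epsilon>" by simp
  qed
  have sym: "f (- x) = - f x" for x
  proof (rule antisym)
    show "- f x \<le> f (- x)" using add_le[of x "- x"] f_0 by simp
    \<comment> \<open>Replacing x by a nearby y in D costs the distance twice, by subadditivity and
      the bound of f by the norm.\<close>
    have "f x + f (- x) \<le> 0"
    proof (rule field_le_epsilon)
      fix \<epsilon> :: real assume "0 < \<epsilon>"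
      then obtain y where y: "y \<in> D" "norm (x - y) < \<epsilon> / 2" using dense[of "\<epsilon> / 2" x] by auto
      have "f x \<le> f y + norm (x - y)"
        using add_le[of y "x - y"] f_le_norm[of "x - y"] by simp
      moreover have "f (- x) \<le> f (- y) + norm (x - y)"
        using add_le[of "- y" "y - x"] f_le_norm[of "y - x"] by (simp add: norm_minus_commute)
      ultimately show "f x + f (- x) \<le> 0 + \<epsilon>" using sym_D[OF y(1)] y(2) by linarith
    qed
    then show "f (- x) \<le> - f x" by simp
  qed
  have add: "f (x + y) = f x + f y" for x y
    using add_le[of x y] add_le[of "- x" "- y"] sym[of "x + y"] sym[of x] sym[of y] by simp
  have scale: "f (c *\<^sub>R x) = c * f x" for c x
  proof -
    consider "0 < c" | "c = 0" | "0 < - c" by linarith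
    then show ?thesis
    proof cases
      case 3
      from f_scale[OF 3, of "- x"] sym[of x] show ?thesis by simp
    qed (use f_scale f_0 in auto)
  qed
  have abs_f: "\<bar>f x\<bar> \<le> norm x" for x
    using f_le_norm[of x] f_le_norm[of "- x"] sym[of x] by simp
  have up: "t * f x \<le> norm (z + t *\<^sub>R x) - norm z" if "0 < t" for x t
    using f_le[OF that, of x] that unfolding \<phi>_def by (simp add: pos_le_divide_eq mult.commute)
  show thesis
  proof (rule that)
    show "bounded_linear f"
      by (rule bounded_linear_intro[where K = 1]) (use add scale abs_f in auto)
    show "f z = norm z"
    proof (rule antisym[OF f_le_norm le_f])
      fix t :: real assume "0 < t"
      have "norm (z + t *\<^sub>R z) = (1 + t) * norm z"
        using \<open>0 < t\<close> norm_scaleR[of "1 + t" z] by (simp add: scaleR_add_left)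
      then show "norm z \<le> \<phi> z t" using \<open>0 < t\<close> by (simp add: \<phi>_def field_simps)
    qed
    show "norm z - norm (z - t *\<^sub>R x) \<le> t * f x" if "0 < t" for x t
      using up[OF that, of "- x"] sym[of x] by simp
  qed (use abs_f up in auto)
qed

section \<open>A computable functional\<close>

text \<open>Used in two ways: as a search result (L', a, m) with step \<open>1 / 2 ^ a\<close> and
  precision m, and as a state (L, r, a) with radius \<open>1 / 2 ^ r\<close> for the next move and
  the exponent a of the last step.\<close>

type_synonym stage = "(int \<times> nat) list \<times> nat \<times> nat"

text \<open>An integer form, with denominators cleared, of \<open>\<parallel>L' - L\<parallel> < 1 / 2\<^sup>r\<close> and
  \<open>second_diff L' X (1 / 2\<^sup>a) < 1 / 2\<^sup>k\<^sup>+\<^sup>a\<close>, where \<open>B _ m\<close> is \<open>2\<^sup>m\<close> times the norm up to an error of 2;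
  the constants 2 and 8 absorb these errors.\<close>

definition flatter :: "(nat \<Rightarrow> nat \<Rightarrow> nat) \<Rightarrow> stage \<Rightarrow> nat \<Rightarrow> (int \<times> nat) list \<Rightarrow> nat \<Rightarrow> (int \<times> nat) list \<Rightarrow> bool" where
  "flatter B c k X r L \<longleftrightarrow> (case c of (L', a, m) \<Rightarrow>
     (B (enc (vcomb L' (-1, 0) L)) m + 2) * 2 ^ r < 2 ^ m \<and>
     (B (enc (vcomb L' (1, 2 ^ a - 1) X)) m + B (enc (vcomb L' (-1, 2 ^ a - 1) X)) m + 8) * 2 ^ (k + a)
       < 2 ^ m + 2 * B (enc L') m * 2 ^ (k + a))"

lemma decidable_flatter:
  assumes B: "computable (\<lambda>y. B (fst y) (snd y))"
    and "computable c" "computable k" "computable X" "computable r" "computable L"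
  shows "decidable (\<lambda>x. flatter B (c x) (k x) (X x) (r x) (L x))"
  unfolding flatter_def case_prod_unfold
  by (intro comp_intro computable_comp2[OF B] assms)

text \<open>Denominators are stored minus one, so \<open>(1, 2 ^ a - 1)\<close> is the step
  \<open>1 / 2 ^ a\<close> and \<open>(-1, 0)\<close> is the scalar -1.\<close>

lemma rvec_dyadic:
  "rvec e (vcomb L (1, 2 ^ a - 1) X) = rvec e L + (1 / 2 ^ a) *\<^sub>R rvec e X"
  "rvec e (vcomb L (-1, 2 ^ a - 1) X) = rvec e L - (1 / 2 ^ a) *\<^sub>R rvec e X"
  "rvec e (vcomb L (-1, 0) X) = rvec e L - rvec e X"
  by (simp_all add: rvec_vcomb q2r_def of_nat_diff)

text \<open>The 8 is an error of 2 for each of the two shifted norms and of 4 for the doubled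
  central norm.\<close>

lemma flatter_sound:
  assumes B: "\<And>j m. \<bar>2 ^ m * norm (ratcomb e j) - real (B j m)\<bar> \<le> 2"
    and fl: "flatter B (L', a, m) k X r L"
  shows "norm (rvec e L' - rvec e L) < 1 / 2 ^ r"
    and "second_diff (rvec e L') (rvec e X) (1 / 2 ^ a) < 1 / 2 ^ (k + a)"
proof -
  note B' = B[of m "enc (vcomb L' (-1, 0) L)"] B[of m "enc (vcomb L' (1, 2 ^ a - 1) X)"]
      B[of m "enc (vcomb L' (-1, 2 ^ a - 1) X)"]
  let ?B = "\<lambda>L. B (enc L) m"
  have "real ((?B (vcomb L' (-1, 0) L) + 2) * 2 ^ r) < real (2 ^ m)"
    using fl unfolding flatter_def by (simp only: of_nat_less_iff prod.case)
  then have "(real (?B (vcomb L' (-1, 0) L)) + 2) * 2 ^ r < 2 ^ m" by (simp add: algebra_simps)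
  moreover have "2 ^ m * norm (rvec e L' - rvec e L) \<le> real (?B (vcomb L' (-1, 0) L)) + 2"
    using B'(1) unfolding rvec_dyadic by linarith
  then have "2 ^ m * norm (rvec e L' - rvec e L) * 2 ^ r \<le> (real (?B (vcomb L' (-1, 0) L)) + 2) * 2 ^ r"
    by (rule mult_right_mono) simp
  ultimately have "2 ^ m * norm (rvec e L' - rvec e L) * 2 ^ r < 2 ^ m"
    by (rule le_less_trans[rotated])
  then have "2 ^ m * (norm (rvec e L' - rvec e L) * 2 ^ r) < 2 ^ m * 1"
    by (simp only: mult.assoc mult_1_right)
  then have "norm (rvec e L' - rvec e L) * 2 ^ r < 1" by simp
  then show "norm (rvec e L' - rvec e L) < 1 / 2 ^ r" by (simp add: pos_less_divide_eq)
  let ?S = "second_diff (rvec e L') (rvec e X) (1 / 2 ^ a)"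
  have "real ((?B (vcomb L' (1, 2 ^ a - 1) X) + ?B (vcomb L' (-1, 2 ^ a - 1) X) + 8) * 2 ^ (k + a))
      < real (2 ^ m + 2 * ?B L' * 2 ^ (k + a))"
    using fl unfolding flatter_def by (simp only: of_nat_less_iff prod.case)
  then have "(real (?B (vcomb L' (1, 2 ^ a - 1) X)) + real (?B (vcomb L' (-1, 2 ^ a - 1) X)) + 8 - 2 * real (?B L')) * 2 ^ (k + a) < 2 ^ m"
    by (simp add: algebra_simps)
  moreover have "2 ^ m * ?S \<le> real (?B (vcomb L' (1, 2 ^ a - 1) X)) + real (?B (vcomb L' (-1, 2 ^ a - 1) X)) + 8 - 2 * real (?B L')"
    using B'(2,3) B[of m "enc L'"] unfolding rvec_dyadic second_diff_def
    by (simp add: distrib_left right_diff_distrib abs_le_iff)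
  then have "2 ^ m * ?S * 2 ^ (k + a) \<le> (real (?B (vcomb L' (1, 2 ^ a - 1) X)) + real (?B (vcomb L' (-1, 2 ^ a - 1) X)) + 8 - 2 * real (?B L')) * 2 ^ (k + a)"
    by (rule mult_right_mono) simp
  ultimately have "2 ^ m * ?S * 2 ^ (k + a) < 2 ^ m"
    by (rule le_less_trans[rotated])
  then have "2 ^ m * (?S * 2 ^ (k + a)) < 2 ^ m * 1"
    by (simp only: mult.assoc mult_1_right)
  then have "?S * 2 ^ (k + a) < 1" by simp
  then show "?S < 1 / 2 ^ (k + a)" by (simp add: pos_less_divide_eq)
qed

text \<open>Telescoping provides a point where both inequalities are strict, and a high precision m
  leaves room for all rounding errors.\<close>

lemma flatter_ex:
  assumes B: "\<And>j m. \<bar>2 ^ m * norm (ratcomb e j) - real (B j m)\<bar> \<le> 2"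
  shows "\<exists>c. flatter B c k X r L"
proof -
  obtain a l where al: "norm ((real l / 2 ^ a) *\<^sub>R rvec e X) < 1 / 2 ^ r"
    "second_diff (rvec e L + (real l / 2 ^ a) *\<^sub>R rvec e X) (rvec e X) (1 / 2 ^ a) < (1 / 2 ^ k) / 2 ^ a"
    using second_diff_small_nearby[of "1 / 2 ^ r" "1 / 2 ^ k" "rvec e X" "rvec e L"] by auto
  define L' where "L' = vcomb L (int l, 2 ^ a - 1) X"
  have L': "rvec e L' = rvec e L + (real l / 2 ^ a) *\<^sub>R rvec e X"
    unfolding L'_def by (simp add: rvec_vcomb q2r_def of_nat_diff)
  let ?S = "second_diff (rvec e L') (rvec e X) (1 / 2 ^ a)"
  let ?d = "norm (rvec e L' - rvec e L)"
  have d: "0 < 1 / 2 ^ r - ?d" and S: "0 < 1 / 2 ^ (k + a) - ?S"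
    using al unfolding L' by (simp_all add: power_add)
  \<comment> \<open>Both margins count errors twice, once in the approximations and once in the
    constants of the test: 4 = 2 + 2 and 16 = 8 + 8.\<close>
  obtain m where m: "4 / (1 / 2 ^ r - ?d) + 16 / (1 / 2 ^ (k + a) - ?S) < 2 ^ m"
    using real_arch_pow[of 2] by auto
  have "4 / (1 / 2 ^ r - ?d) < 2 ^ m" "16 / (1 / 2 ^ (k + a) - ?S) < 2 ^ m"
    using m d S divide_pos_pos[of 4 "1 / 2 ^ r - ?d"] divide_pos_pos[of 16 "1 / 2 ^ (k + a) - ?S"]
    by linarith+
  then have m1: "4 + 2 ^ m * ?d < 2 ^ m / 2 ^ r" and m2: "16 + 2 ^ m * ?S < 2 ^ m / 2 ^ (k + a)"
    using d S by (simp_all add: pos_divide_less_eq right_diff_distrib)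
  note B' = B[of m "enc (vcomb L' (-1, 0) L)"] B[of m "enc (vcomb L' (1, 2 ^ a - 1) X)"]
      B[of m "enc (vcomb L' (-1, 2 ^ a - 1) X)"]
  let ?B = "\<lambda>L. B (enc L) m"
  have "real (?B (vcomb L' (-1, 0) L)) + 2 < 2 ^ m / 2 ^ r"
    using B'(1) m1 unfolding rvec_dyadic by linarith
  then have "(real (?B (vcomb L' (-1, 0) L)) + 2) * 2 ^ r < 2 ^ m"
    by (simp add: pos_less_divide_eq)
  then have "real ((?B (vcomb L' (-1, 0) L) + 2) * 2 ^ r) < real (2 ^ m)" by (simp add: algebra_simps)
  then have 1: "(?B (vcomb L' (-1, 0) L) + 2) * 2 ^ r < 2 ^ m" by (simp only: of_nat_less_iff)
  have "real (?B (vcomb L' (1, 2 ^ a - 1) X)) + real (?B (vcomb L' (-1, 2 ^ a - 1) X)) + 8 - 2 * real (?B L') < 2 ^ m / 2 ^ (k + a)"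
    using B'(2,3) B[of m "enc L'"] m2 unfolding rvec_dyadic second_diff_def
    by (simp add: distrib_left right_diff_distrib abs_le_iff)
  then have "(real (?B (vcomb L' (1, 2 ^ a - 1) X)) + real (?B (vcomb L' (-1, 2 ^ a - 1) X)) + 8 - 2 * real (?B L')) * 2 ^ (k + a) < 2 ^ m"
    by (simp only: pos_less_divide_eq zero_less_power zero_less_numeral)
  then have "real ((?B (vcomb L' (1, 2 ^ a - 1) X) + ?B (vcomb L' (-1, 2 ^ a - 1) X) + 8) * 2 ^ (k + a))
      < real (2 ^ m + 2 * ?B L' * 2 ^ (k + a))"
    by (simp add: algebra_simps)
  then have 2: "(?B (vcomb L' (1, 2 ^ a - 1) X) + ?B (vcomb L' (-1, 2 ^ a - 1) X) + 8) * 2 ^ (k + a)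
      < 2 ^ m + 2 * ?B L' * 2 ^ (k + a)"
    by (simp only: of_nat_less_iff)
  show ?thesis
    by (intro exI[of _ "(L', a, m)"]) (simp only: flatter_def prod.case 1 2 simp_thms)
qed

text \<open>Stage n, read as a pair (j, k), moves to a nearby combination that is flat along
  \<open>ratcomb e j\<close> to accuracy k. Later moves are too small to destroy this, so the limit
  w is smooth in a dense set of directions, and each stage also yields a difference quotient
  approximating f there.\<close>

lemma computable_functional:
  fixes e :: "nat \<Rightarrow> 'a::banach"
  assumes "computable_banach e" and "\<exists>x::'a. x \<noteq> 0"
  obtains f :: "'a \<Rightarrow> real" and z c
  where "bounded_linear f" "\<And>x. \<bar>f x\<bar> \<le> norm x" "f z = norm z" "z \<noteq> 0"
    "computable (\<lambda>y. c (fst y) (snd y))" "\<And>j k. \<bar>f (ratcomb e j) - q2r (c j k)\<bar> \<le> inverse (2 ^ k)"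
proof -
  obtain B where B: "computable (\<lambda>y. B (fst y) (snd y))"
    "\<And>j m. \<bar>2 ^ m * norm (ratcomb e j) - real (B j m)\<bar> \<le> 2"
    using computable_norm_approx[OF assms(1)] by blast
  have dense: "closure (span (range e)) = UNIV"
    using assms(1) unfolding computable_banach_def by blast
  obtain L0 where L0: "rvec e L0 \<noteq> 0"
  proof -
    obtain x :: 'a where "x \<noteq> 0" using assms(2) by blast
    then obtain L where "dist (rvec e L) x < norm x" using rvec_dense[OF dense, of "norm x" x] by auto
    then have "rvec e L \<noteq> 0" by (auto simp: dist_norm)
    then show thesis by (rule that)
  qed
  \<comment> \<open>All moves together are at most \<open>2 / 2 ^ r0\<close>, less than the norm of
    the starting point, so the limit is not 0.\<close>
  obtain r0 where "2 / norm (rvec e L0) < 2 ^ r0"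
    using real_arch_pow[of 2] by auto
  then have r0: "2 / 2 ^ r0 < norm (rvec e L0)"
    using L0 by (simp add: field_simps)
  define wit :: "nat \<Rightarrow> stage \<Rightarrow> stage" where
    "wit n s = search (\<lambda>c. flatter B c (snd (dec n :: nat \<times> nat)) (dec (fst (dec n :: nat \<times> nat))) (fst (snd s)) (fst s))" for n s
  \<comment> \<open>Adding the step exponent and k to the radius exponent keeps the sum of all later
    moves below \<open>1 / 2 ^ (k + a)\<close>, the scale of the flatness just achieved. The
    \<open>Suc\<close> absorbs the factor 2 of the geometric series.\<close>
  define nxt :: "nat \<Rightarrow> stage \<Rightarrow> stage" where
    "nxt n s = (fst (wit n s), Suc (fst (snd s) + fst (snd (wit n s)) + snd (dec n :: nat \<times> nat)), fst (snd (wit n s)))" for n s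
  define S :: "nat \<Rightarrow> stage" where "S = rec_nat (L0, r0, 0) nxt"
  define z where "z n = rvec e (fst (S n))" for n
  define r where "r n = fst (snd (S n))" for n
  define a where "a n = snd (snd (S n))" for n
  have "computable (\<lambda>y. wit (fst y) (snd y))"
    unfolding wit_def
    by (rule computable_search) (intro decidable_flatter comp_intro B flatter_ex[OF B(2)])+
  then have "computable (\<lambda>y. nxt (fst y) (snd y))"
    unfolding nxt_def by (intro comp_intro)
  then have "computable (\<lambda>y::nat \<times> stage \<times> nat. nxt (fst y) (fst (snd y)))"
    by (rule computable_comp2) (intro comp_intro)+
  then have S: "computable S"
    unfolding S_def by (rule computable_rec_nat[OF computable_const _ computable_id])
  have S_Suc: "S (Suc n) = nxt n (S n)" for n by (simp add: S_def)
  have stage: "flatter B (wit n s) (snd (dec n :: nat \<times> nat)) (dec (fst (dec n :: nat \<times> nat))) (fst (snd s)) (fst s)" for n s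
    unfolding wit_def by (rule search[OF flatter_ex[OF B(2)]])
  have z_Suc: "norm (z (Suc n) - z n) < 1 / 2 ^ r n"
    and sd: "second_diff (z (Suc n)) (ratcomb e (fst (dec n :: nat \<times> nat))) (1 / 2 ^ a (Suc n))
       < 1 / 2 ^ (snd (dec n :: nat \<times> nat) + a (Suc n))"
    and r_Suc: "r (Suc n) = Suc (r n + a (Suc n) + snd (dec n :: nat \<times> nat))" for n
  proof -
    obtain L' a' m where w: "wit n (S n) = (L', a', m)" by (metis prod.exhaust)
    from flatter_sound[OF B(2) stage[of n "S n", unfolded w]]
    show "norm (z (Suc n) - z n) < 1 / 2 ^ r n"
      "second_diff (z (Suc n)) (ratcomb e (fst (dec n :: nat \<times> nat))) (1 / 2 ^ a (Suc n))
       < 1 / 2 ^ (snd (dec n :: nat \<times> nat) + a (Suc n))"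
      "r (Suc n) = Suc (r n + a (Suc n) + snd (dec n :: nat \<times> nat))"
      by (simp_all add: z_def r_def a_def S_Suc nxt_def w)
  qed
  \<comment> \<open>As r grows by at least one per stage, \<open>1 / 2 ^ r n\<close> is at most
    \<open>2 / 2 ^ r n - 2 / 2 ^ r (Suc n)\<close>; bounding by a difference lets the induction
    telescope.\<close>
  have close: "norm (z (n + d) - z n) \<le> 2 / 2 ^ r n - 2 / 2 ^ r (n + d)" for n d
  proof (induction d)
    case (Suc d)
    have "(2::real) ^ Suc (r (n + d)) \<le> 2 ^ r (Suc (n + d))"
      unfolding r_Suc by (intro power_increasing) auto
    then have "2 / 2 ^ r (Suc (n + d)) \<le> 1 / (2::real) ^ r (n + d)"
      by (simp add: field_simps)
    moreover have "norm (z (Suc (n + d)) - z n) \<le> norm (z (Suc (n + d)) - z (n + d)) + norm (z (n + d) - z n)"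
      using norm_triangle_ineq[of "z (Suc (n + d)) - z (n + d)" "z (n + d) - z n"] by simp
    ultimately show ?case using Suc z_Suc[of "n + d"] by simp
  qed simp
  have close': "norm (z m - z n) \<le> 2 / 2 ^ r n" if "n \<le> m" for n m
  proof -
    have "norm (z m - z n) \<le> 2 / 2 ^ r n - 2 / 2 ^ r m"
      using close[of n "m - n"] that by simp
    moreover have "0 \<le> 2 / (2::real) ^ r m" by simp
    ultimately show ?thesis by linarith
  qed
  have r_ge: "n \<le> r n" for n
    by (induction n) (simp_all add: r_Suc)
  have "Cauchy z"
  proof (rule CauchyI')
    fix \<epsilon> :: real assume "0 < \<epsilon>"
    obtain M where "2 / \<epsilon> < 2 ^ M" using real_arch_pow[of 2] by auto
    then have M: "2 / 2 ^ M < \<epsilon>" using \<open>0 < \<epsilon>\<close> by (simp add: field_simps)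
    have "dist (z m) (z n) < \<epsilon>" if "M \<le> m" "m < n" for m n
    proof -
      have "norm (z n - z m) \<le> 2 / 2 ^ r m"
        using close'[of m n] that by simp
      also have "\<dots> \<le> 2 / 2 ^ M"
        using r_ge[of m] that by (intro divide_left_mono power_increasing) auto
      also note M
      finally show ?thesis by (simp add: dist_norm norm_minus_commute)
    qed
    then show "\<exists>M. \<forall>m\<ge>M. \<forall>n>m. dist (z m) (z n) < \<epsilon>" by blast
  qed
  then obtain w where w: "z \<longlonglongrightarrow> w" using Cauchy_convergent convergent_def by blast
  have w_close: "norm (w - z n) \<le> 2 / 2 ^ r n" for n
  proof (rule LIMSEQ_le_const2)
    show "(\<lambda>m. norm (z m - z n)) \<longlonglongrightarrow> norm (w - z n)"
      by (intro tendsto_intros w)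
    show "\<exists>N. \<forall>m\<ge>N. norm (z m - z n) \<le> 2 / 2 ^ r n" using close' by blast
  qed
  have "w \<noteq> 0"
    using w_close[of 0] r0 by (auto simp: z_def r_def S_def)
  define idx where "idx j k = enc (j, k)" for j k :: nat
  \<comment> \<open>The pair (j, k) is treated at stage \<open>idx j k\<close>, and the outcome sits
    in the following state.\<close>
  define A where "A j k = a (Suc (idx j k))" for j k
  define y where "y j k = z (Suc (idx j k))" for j k
  have wy: "norm (w - y j k) \<le> 1 / 2 ^ (k + A j k)" for j k
  proof -
    have "norm (w - y j k) \<le> 2 / 2 ^ r (Suc (idx j k))"
      unfolding y_def by (rule w_close)
    also have "\<dots> \<le> 2 / 2 ^ Suc (k + A j k)"
      unfolding r_Suc A_def by (intro divide_left_mono power_increasing) (auto simp: idx_def)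
    finally show ?thesis by simp
  qed
  \<comment> \<open>Here 5 is 1 for the stage point plus 4 for moving from it to w.\<close>
  have sd_w: "second_diff w (ratcomb e j) (1 / 2 ^ A j k) < 5 / 2 ^ (k + A j k)" for j k
  proof -
    have "second_diff (y j k) (ratcomb e j) (1 / 2 ^ A j k) < 1 / 2 ^ (k + A j k)"
      using sd[of "idx j k"] by (simp add: idx_def y_def A_def)
    then show ?thesis
      using second_diff_lipschitz[of w "ratcomb e j" "1 / 2 ^ A j k" "y j k"] wy[of j k] by simp
  qed
  have dense': "\<exists>v\<in>range (ratcomb e). norm (x - v) < d" if "0 < d" for x d
    using rvec_dense[OF dense that, of x] by (auto simp: dist_norm norm_minus_commute)
  have smooth: "\<exists>t>0. second_diff w x t < \<epsilon> * t" if x_range: "x \<in> range (ratcomb e)" and "0 < \<epsilon>" for x \<epsilon>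
  proof -
    obtain j where x: "x = ratcomb e j" using x_range by blast
    obtain k where "5 / \<epsilon> < 2 ^ k" using real_arch_pow[of 2] by auto
    then have "5 / 2 ^ k < \<epsilon>" using \<open>0 < \<epsilon>\<close> by (simp add: field_simps)
    then have "5 / 2 ^ k * (1 / 2 ^ A j k) < \<epsilon> * (1 / 2 ^ A j k)"
      by (intro mult_strict_right_mono) auto
    then have "5 / 2 ^ (k + A j k) < \<epsilon> * (1 / 2 ^ A j k)" by (simp add: power_add)
    then show ?thesis unfolding x using sd_w[of j k] by (intro exI[of _ "1 / 2 ^ A j k"]) auto
  qed
  obtain f where f: "bounded_linear f" "\<And>x. \<bar>f x\<bar> \<le> norm x" "f w = norm w"
    "\<And>x t. 0 < t \<Longrightarrow> t * f x \<le> norm (w + t *\<^sub>R x) - norm w"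
    "\<And>x t. 0 < t \<Longrightarrow> norm w - norm (w - t *\<^sub>R x) \<le> t * f x"
    using norm_smooth_point_functional[OF dense' smooth] by metis
  \<comment> \<open>The difference quotient at the stage point as a fraction over
    \<open>2 ^ (k + 4)\<close>: precision m exceeds k + 4 by the step exponent, so
    \<open>2 ^ m\<close> contains the reciprocal of the step.\<close>
  define c where "c j k = (let s = S (Suc (idx j (k + 4))); m = k + 4 + snd (snd s) in
      (int (B (enc (vcomb (fst s) (1, 2 ^ snd (snd s) - 1) (dec j))) m) + - int (B (enc (fst s)) m), 2 ^ (k + 4) - 1 :: nat))" for j k
  have "computable (\<lambda>y. c (fst y) (snd y))"
    unfolding c_def Let_def idx_def
    by (intro comp_intro computable_comp2[OF B(1)] computable_comp[OF S])
  moreover have "\<bar>f (ratcomb e j) - q2r (c j k)\<bar> \<le> inverse (2 ^ k)" for j k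
  proof -
    define k4 where "k4 = k + 4"
    define t :: real where "t = 1 / 2 ^ A j k4"
    define m where "m = k4 + A j k4"
    have t: "0 < t" by (simp add: t_def)
    let ?x = "ratcomb e j" and ?y = "y j k4"
    have tm: "1 / 2 ^ (k4 + A j k4) = t / 2 ^ k4" by (simp add: t_def power_add)
    have m: "2 ^ m = 2 ^ k4 / t" by (simp add: m_def t_def power_add)
    define P where "P = B (enc (vcomb (fst (S (Suc (idx j k4)))) (1, 2 ^ A j k4 - 1) (dec j))) m"
    define Q where "Q = B (enc (fst (S (Suc (idx j k4))))) m"
    have c: "q2r (c j k) = (real P - real Q) / 2 ^ k4"
      by (simp add: c_def q2r_def P_def Q_def k4_def m_def A_def a_def Let_def of_nat_diff)
    have PQ: "\<bar>2 ^ m * norm (?y + t *\<^sub>R ?x) - P\<bar> \<le> 2" "\<bar>2 ^ m * norm ?y - Q\<bar> \<le> 2"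
      using B(2)[of m "enc (vcomb (fst (S (Suc (idx j k4)))) (1, 2 ^ A j k4 - 1) (dec j))"]
        B(2)[of m "enc (fst (S (Suc (idx j k4))))"]
      unfolding P_def Q_def rvec_dyadic by (simp_all add: y_def z_def t_def)
    have "\<bar>2 ^ m * (norm (?y + t *\<^sub>R ?x) - norm ?y) - (real P - real Q)\<bar> \<le> 4"
      using PQ by (simp add: right_diff_distrib abs_le_iff)
    then have "t / 2 ^ k4 * \<bar>2 ^ m * (norm (?y + t *\<^sub>R ?x) - norm ?y) - (real P - real Q)\<bar> \<le> t / 2 ^ k4 * 4"
      using t by (intro mult_left_mono) auto
    then have "\<bar>t / 2 ^ k4 * (2 ^ m * (norm (?y + t *\<^sub>R ?x) - norm ?y) - (real P - real Q))\<bar> \<le> t / 2 ^ k4 * 4"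
      using t by (simp add: abs_mult)
    moreover have "t / 2 ^ k4 * (2 ^ m * (norm (?y + t *\<^sub>R ?x) - norm ?y) - (real P - real Q))
        = (norm (?y + t *\<^sub>R ?x) - norm ?y) - t * q2r (c j k)"
      using t unfolding m c by (simp add: field_simps)
    ultimately have 1: "\<bar>(norm (?y + t *\<^sub>R ?x) - norm ?y) - t * q2r (c j k)\<bar> \<le> t / 2 ^ k4 * 4"
      by (simp only:)
    have wy': "norm (w - ?y) \<le> t / 2 ^ k4" using wy[of j k4] unfolding tm .
    have 2: "\<bar>norm (w + t *\<^sub>R ?x) - norm (?y + t *\<^sub>R ?x)\<bar> \<le> t / 2 ^ k4"
      using norm_triangle_ineq3[of "w + t *\<^sub>R ?x" "?y + t *\<^sub>R ?x"] wy' by simp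
    have 3: "\<bar>norm w - norm ?y\<bar> \<le> t / 2 ^ k4"
      using norm_triangle_ineq3[of w ?y] wy' by simp
    have "second_diff w ?x t < 5 * (t / 2 ^ k4)"
      using sd_w[of j k4] unfolding t_def[symmetric] using tm by simp
    then have "norm (w + t *\<^sub>R ?x) - norm w - (norm w - norm (w - t *\<^sub>R ?x)) < 5 * (t / 2 ^ k4)"
      unfolding second_diff_def by simp
    with f(4)[OF t, of ?x] f(5)[OF t, of ?x] 1 2 3
    \<comment> \<open>In units of \<open>t / 2 ^ k4\<close> the errors are 4 from rounding, 2 from
      replacing w by the stage point and 5 from the bracket. Their sum 11 is below 16, which
      explains the offset 4 in k4.\<close>
    have "\<bar>t * f ?x - t * q2r (c j k)\<bar> \<le> 16 * (t / 2 ^ k4)"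
      using t zero_le_divide_iff[of t "2 ^ k4"] by (simp add: abs_le_iff)
    also have "\<dots> = t * inverse (2 ^ k)"
      by (simp add: k4_def power_add field_simps)
    finally have "t * \<bar>f ?x - q2r (c j k)\<bar> \<le> t * inverse (2 ^ k)"
      using t by (simp add: abs_mult flip: right_diff_distrib)
    then show ?thesis using t by simp
  qed
  ultimately show thesis using that[OF f(1,2,3) \<open>w \<noteq> 0\<close>] by blast
qed

section \<open>The reduction from closed choice\<close>

definition least_missing :: "(nat \<Rightarrow> nat) \<Rightarrow> nat \<Rightarrow> nat" where
  "least_missing p s = (LEAST n. \<forall>t<s. p t \<noteq> Suc n)"

text \<open>Guesses never decrease, so the first stage showing the current guess is the last one at
  which the guess changed.\<close>

definition last_change :: "(nat \<Rightarrow> nat) \<Rightarrow> nat \<Rightarrow> nat" where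
  "last_change p i = (LEAST s. least_missing p s = least_missing p i)"

text \<open>The successor of the sum of the first s digits exceeds each of them.\<close>

lemma least_missing_ex:
  fixes p :: "nat \<Rightarrow> nat"
  shows "\<exists>n. \<forall>t<s. p t \<noteq> Suc n"
proof (intro exI allI impI)
  fix t assume "t < s"
  then have "p t \<le> sum p {..<s}" by (intro member_le_sum) auto
  then show "p t \<noteq> Suc (sum p {..<s})" by simp
qed

lemma least_missing_cong: "(\<And>t. t < s \<Longrightarrow> p t = q t) \<Longrightarrow> least_missing p s = least_missing q s"
  unfolding least_missing_def by (intro arg_cong[where f = Least]) auto

lemma least_missing_mono: "s \<le> s' \<Longrightarrow> least_missing p s \<le> least_missing p s'"
  using LeastI_ex[OF least_missing_ex[where p = p and s = s']] unfolding least_missing_def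
  by (intro Least_le) auto

lemma least_missing_le: "Suc n \<notin> range p \<Longrightarrow> least_missing p s \<le> n"
  unfolding least_missing_def by (intro Least_le) (metis rangeI)

lemma last_change_le: "least_missing p s = least_missing p i \<Longrightarrow> last_change p i \<le> s"
  unfolding last_change_def by (rule Least_le)

lemma least_missing_last_change: "least_missing p (last_change p i) = least_missing p i"
  unfolding last_change_def by (rule LeastI) (rule refl)

text \<open>Only stages up to i are compared, and there p and q produce the same guesses. Hence
  \<open>last_change p i\<close> is computable from the first i digits.\<close>

lemma last_change_cong:
  assumes "\<And>t. t < i \<Longrightarrow> p t = q t"
  shows "last_change p i = last_change q i"
proof (rule antisym)
  have *: "last_change p i \<le> last_change q i" if "\<And>t. t < i \<Longrightarrow> p t = q t" for p q
  proof (rule last_change_le)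
    have "last_change q i \<le> i" by (rule last_change_le) simp
    then have "least_missing p (last_change q i) = least_missing q (last_change q i)"
      using that by (intro least_missing_cong) auto
    also have "\<dots> = least_missing q i" by (rule least_missing_last_change)
    also have "\<dots> = least_missing p i" using that by (intro least_missing_cong) auto
    finally show "least_missing p (last_change q i) = least_missing p i" .
  qed
  show "last_change p i \<le> last_change q i" "last_change q i \<le> last_change p i"
    by (rule *, simp add: assms)+
qed

text \<open>Each number below the minimum m is enumerated at some stage, and the sum of these
  finitely many stages bounds them all.\<close>

lemma least_missing_stabilises:
  assumes "{n. Suc n \<notin> range p} \<noteq> {}"
  shows "\<exists>m s0. Suc m \<notin> range p \<and> (\<forall>s\<ge>s0. least_missing p s = m)"
proof -
  define m where "m = (LEAST n. Suc n \<notin> range p)"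
  have m: "Suc m \<notin> range p" unfolding m_def using LeastI_ex[of "\<lambda>n. Suc n \<notin> range p"] assms by blast
  have "\<forall>n<m. \<exists>t. p t = Suc n"
  proof (intro allI impI)
    fix n assume "n < m"
    then have "Suc n \<in> range p" unfolding m_def using not_less_Least by blast
    then show "\<exists>t. p t = Suc n" by (metis rangeE)
  qed
  then obtain t where t: "\<And>n. n < m \<Longrightarrow> p (t n) = Suc n" by metis
  define s0 where "s0 = Suc (sum t {..<m})"
  have t_less: "t n < s0" if "n < m" for n
  proof -
    have "t n \<le> sum t {..<m}" using that by (intro member_le_sum) auto
    then show ?thesis by (simp add: s0_def)
  qed
  have "least_missing p s = m" if "s0 \<le> s" for s
    unfolding least_missing_def
  proof (rule Least_equality)
    show "\<forall>t<s. p t \<noteq> Suc m" using m by (metis rangeI)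
    fix n assume n: "\<forall>t<s. p t \<noteq> Suc n"
    show "m \<le> n"
    proof (rule ccontr)
      assume "\<not> m \<le> n"
      then have "n < m" by simp
      with t t_less n that show False by (meson less_le_trans)
    qed
  qed
  with m show ?thesis by blast
qed

lemma last_change_bounded:
  assumes "\<forall>s\<ge>s0. least_missing p s = m"
  shows "last_change p i \<le> s0"
proof (cases "i \<le> s0")
  case True
  have "last_change p i \<le> i" by (rule last_change_le) simp
  with True show ?thesis by simp
next
  case False
  with assms show ?thesis by (intro last_change_le) simp
qed

text \<open>M is no earlier than the first stage with the final guess. From then on the guess cannot
  drop, by monotonicity, nor pass m, which is never enumerated.\<close>

lemma least_missing_of_bound:
  assumes stab: "\<forall>s\<ge>s0. least_missing p s = m" and m: "Suc m \<notin> range p"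
    and M: "\<And>i. last_change p i \<le> M"
  shows "least_missing p M = m"
proof (rule antisym[OF least_missing_le[OF m]])
  have "m = least_missing p (last_change p s0)"
    using stab by (simp add: least_missing_last_change)
  also have "\<dots> \<le> least_missing p M" by (rule least_missing_mono[OF M])
  finally show "m \<le> least_missing p M" .
qed

lemma computable_least_missing:
  fixes q :: "'a::coded \<Rightarrow> nat \<Rightarrow> nat"
  assumes q: "computable (\<lambda>y. q (fst y) (snd y))" and s: "computable s"
  shows "computable (\<lambda>x. least_missing (q x) (s x))"
  unfolding least_missing_def
  by (intro comp_intro computable_comp2[OF q] computable_comp[OF s] least_missing_ex)

text \<open>K cannot know when the guesses stabilise, but stabilisation ensures that the operators
  form a bounded family. A bound returned for them is a safe stage at which H reads off the
  guess.\<close>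

lemma CN_le_UBT:
  fixes eX :: "nat \<Rightarrow> 'x::banach" and eY :: "nat \<Rightarrow> 'y::banach"
  assumes cX: "computable_banach eX" and cY: "computable_banach eY"
    and nX: "\<exists>x::'x. x \<noteq> 0" and nY: "\<exists>y::'y. y \<noteq> 0"
  shows "W_le neg_rep nat_rep CN_dom CN_map (seq_rep (fun_rep (cauchy_rep eX) (cauchy_rep eY))) nat_rep
      (UBT_dom :: (nat \<Rightarrow> ('x \<Rightarrow> 'y)) set) UBT_map"
proof -
  have denseX: "closure (span (range eX)) = UNIV" and denseY: "closure (span (range eY)) = UNIV"
    using cX cY unfolding computable_banach_def by blast+
  obtain f :: "'x \<Rightarrow> real" and z c where f: "bounded_linear f" "\<And>x. \<bar>f x\<bar> \<le> norm x" "f z = norm z" "z \<noteq> 0"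
    and c: "computable (\<lambda>y. c (fst y) (snd y))" "\<And>j k. \<bar>f (ratcomb eX j) - q2r (c j k)\<bar> \<le> inverse (2 ^ k)"
    using computable_functional[OF cX nX] by blast
  \<comment> \<open>Approximating a vector of norm 2 within 1 gives a rational combination of norm
    at least 1, so the norm of \<open>T i\<close> is not below the factor
    \<open>last_change p i\<close>.\<close>
  obtain Y where Y: "1 \<le> norm (rvec eY Y)"
  proof -
    obtain y :: 'y where y: "y \<noteq> 0" using nY by blast
    obtain L where "dist (rvec eY L) ((2 / norm y) *\<^sub>R y) < 1"
      using rvec_dense[OF denseY, of 1] by auto
    moreover have "norm ((2 / norm y) *\<^sub>R y) = 2" using y by simp
    ultimately have "1 \<le> norm (rvec eY L)"
      using norm_triangle_ineq2[of "(2 / norm y) *\<^sub>R y" "rvec eY L"]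
      by (simp add: dist_norm norm_minus_commute)
    then show thesis by (rule that)
  qed
  obtain b where b: "norm (rvec eY Y) < 2 ^ b" using real_arch_pow[of 2] by auto
  \<comment> \<open>Input digit h yields an output error of at most
    \<open>2 ^ i * (2 * inverse (2 ^ h) * 2 ^ b)\<close>; this h makes it
    \<open>inverse (2 ^ n)\<close>.\<close>
  define depth where "depth i n = n + i + b + 1" for i n
  define val where "val a j h = enc (vcomb [] (qmul (int a, 0) (c j h)) Y)" for a j h
  \<comment> \<open>N is read as a query (i, n, u) to the associate of \<open>T i\<close>. It is
    answered only when u ends with digit h of the argument, so there is one positive answer per
    output digit.\<close>
  define out where "out N w = (let d = dec N :: nat \<times> nat \<times> nat list; i = fst d; u = snd (snd d); h = depth i (fst (snd d))
     in if length u = Suc h then Suc (val (last_change (nth_code w) i) (nth_code u h) h) else 0)" for N w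
  define K where "K p = Some (\<lambda>N. out N (map p [0..<N]))" for p :: baire
  define H where "H v = Some (\<lambda>_::nat. least_missing (\<lambda>n. v (2 * n)) (v 1))" for v :: baire
  have lc: "computable (\<lambda>y::nat list \<times> nat. last_change (nth_code (fst y)) (snd y))"
    unfolding last_change_def by (intro comp_intro computable_least_missing) auto
  have "computable_partial K"
  proof (rule computable_partialI[where g = "\<lambda>N w. if length w = N then Suc (out N w) else 0"])
    show "computable (\<lambda>y. if length (snd y) = fst y then Suc (out (fst y) (snd y)) else 0)"
      unfolding out_def Let_def depth_def val_def qmul_def fst_conv snd_conv
      by (intro comp_intro computable_comp2[OF lc] computable_comp2[OF c(1)])
  qed (auto simp: K_def split: if_splits)
  \<comment> \<open>Digit 1 of the pair is the bound, and the digits of p that matter lie at even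
    positions below twice the bound.\<close>
  moreover have "computable_partial H"
  proof (rule computable_partialI[where g = "\<lambda>n w. if 1 < length w \<and> 2 * nth_code w 1 < length w
      then Suc (least_missing (\<lambda>n. nth_code w (2 * n)) (nth_code w 1)) else 0"])
    show "computable (\<lambda>y::nat \<times> nat list. if 1 < length (snd y) \<and> 2 * nth_code (snd y) 1 < length (snd y)
      then Suc (least_missing (\<lambda>n. nth_code (snd y) (2 * n)) (nth_code (snd y) 1)) else 0)"
      by (intro comp_intro computable_least_missing)
    fix v r n k
    assume v: "H v = Some r"
    have nth_1: "nth_code (map v [0..<k]) 1 = v 1" if "1 < k" for k using that by simp
    show "\<exists>k. 0 < (if 1 < length (map v [0..<k]) \<and> 2 * nth_code (map v [0..<k]) 1 < length (map v [0..<k])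
      then Suc (least_missing (\<lambda>n. nth_code (map v [0..<k]) (2 * n)) (nth_code (map v [0..<k]) 1)) else 0)"
      using nth_1 by (intro exI[of _ "2 * v 1 + 2"]) (simp del: upt_Suc)
    assume "0 < (if 1 < length (map v [0..<k]) \<and> 2 * nth_code (map v [0..<k]) 1 < length (map v [0..<k])
      then Suc (least_missing (\<lambda>n. nth_code (map v [0..<k]) (2 * n)) (nth_code (map v [0..<k]) 1)) else 0)"
    then have k: "1 < k" "2 * v 1 < k" by (auto split: if_splits)
    then have "least_missing (\<lambda>n. nth_code (map v [0..<k]) (2 * n)) (v 1) = r n"
      using v unfolding H_def by (auto intro!: least_missing_cong)
    then show "(if 1 < length (map v [0..<k]) \<and> 2 * nth_code (map v [0..<k]) 1 < length (map v [0..<k])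
      then Suc (least_missing (\<lambda>n. nth_code (map v [0..<k]) (2 * n)) (nth_code (map v [0..<k]) 1)) else 0) = Suc (r n)"
      using k by simp
  qed
  moreover have "realizer neg_rep nat_rep CN_dom CN_map
      (\<lambda>p. case K p of None \<Rightarrow> None
         | Some r \<Rightarrow> (case G r of None \<Rightarrow> None | Some s \<Rightarrow> H (bpair p s)))"
    if G: "realizer (seq_rep (fun_rep (cauchy_rep eX) (cauchy_rep eY))) nat_rep
      (UBT_dom :: (nat \<Rightarrow> ('x \<Rightarrow> 'y)) set) UBT_map G" for G
    unfolding realizer_def
  proof (intro allI impI, elim conjE)
    fix p :: baire and A
    assume "neg_rep p = Some A" and "A \<in> CN_dom"
    then have A: "A = {n. Suc n \<notin> range p}" "{n. Suc n \<notin> range p} \<noteq> {}"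
      unfolding neg_rep_def CN_dom_def by auto
    obtain m s0 where m: "Suc m \<notin> range p" and stab: "\<forall>s\<ge>s0. least_missing p s = m"
      using least_missing_stabilises[OF A(2)] by blast
    define r where "r N = out N (map p [0..<N])" for N
    define T where "T i x = (real (last_change p i) * f x) *\<^sub>R rvec eY Y" for i x
    have bl: "bounded_linear (T i)" for i
      unfolding T_def
      by (intro bounded_linear_scaleR_const bounded_linear_const_mult f(1))
    have lc_le: "last_change p i \<le> i" for i by (rule last_change_le) simp
    have r: "r (prod_encode (i, prod_encode (n, prefix_code x k))) =
        (if k = Suc (depth i n) then Suc (val (last_change p i) (x (depth i n)) (depth i n)) else 0)" for i n x k
    proof -
      let ?N = "prod_encode (i, prod_encode (n, prefix_code x k))"
      have "?N = enc (i, n, map x [0..<k])"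
        by (simp add: enc_prod_def prefix_code_enc enc_nat_def)
      then have d: "(dec ?N :: nat \<times> nat \<times> nat list) = (i, n, map x [0..<k])" by simp
      \<comment> \<open>The pairing gives a code no smaller than i, so the available prefix of p
        determines \<open>last_change p i\<close>.\<close>
      have lc_eq: "last_change (nth_code (map p [0..<?N])) i = last_change p i"
        using le_prod_encode_1[of i "prod_encode (n, prefix_code x k)"] by (intro last_change_cong) simp
      have u: "nth_code (map x [0..<Suc (depth i n)]) (depth i n) = x (depth i n)"
        by (simp del: upt_Suc)
      show ?thesis
        unfolding r_def out_def Let_def d fst_conv snd_conv lc_eq length_map length_upt diff_zero
        by (intro if_cong) (simp_all only: u)
    qed
    have "seq_rep (fun_rep (cauchy_rep eX) (cauchy_rep eY)) r = Some T"
      unfolding seq_rep_iff fun_rep_iff[OF cauchy_rep_surj[OF denseX]]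
    proof (intro allI conjI impI)
      fix i
      show "continuous_on UNIV (T i)" by (rule linear_continuous_on[OF bl])
      fix x \<xi> assume \<xi>: "cauchy_rep eX x = Some \<xi>"
      define v where "v n = val (last_change p i) (x (depth i n)) (depth i n)" for n
      have "eta (\<lambda>n. r (prod_encode (i, n))) x = Some v"
        by (rule eta_eqI) (auto simp: r v_def split: if_splits)
      moreover have "cauchy_rep eY v = Some (T i \<xi>)"
        unfolding cauchy_rep_iff
      proof
        fix n
        define h where "h = depth i n"
        define a where "a = last_change p i"
        have "\<bar>f (ratcomb eX (x h)) - f \<xi>\<bar> \<le> inverse (2 ^ h)"
        proof -
          have "f (ratcomb eX (x h)) - f \<xi> = f (ratcomb eX (x h) - \<xi>)"
            by (simp add: linear_simps(2)[OF f(1)])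
          then show ?thesis
            using f(2)[of "ratcomb eX (x h) - \<xi>"] \<xi> unfolding cauchy_rep_iff
            by (metis dist_norm order_trans)
        qed
        then have q: "\<bar>q2r (c (x h) h) - f \<xi>\<bar> \<le> 2 * inverse (2 ^ h)"
          using c(2)[of "x h" h] by linarith
        have "a \<le> 2 ^ i" using lc_le[of i] less_exp[of i] unfolding a_def by linarith
        then have a: "real a \<le> 2 ^ i" by (metis of_nat_le_iff of_nat_numeral of_nat_power)
        have "dist (ratcomb eY (v n)) (T i \<xi>) = norm ((real a * q2r (c (x h) h)) *\<^sub>R rvec eY Y - (real a * f \<xi>) *\<^sub>R rvec eY Y)"
          unfolding v_def val_def T_def dist_norm h_def[symmetric] a_def[symmetric]
          by (simp add: rvec_vcomb rvec_Nil q2r_qmul) (simp add: q2r_def)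
        also have "\<dots> = real a * (\<bar>q2r (c (x h) h) - f \<xi>\<bar> * norm (rvec eY Y))"
          by (simp add: abs_mult flip: scaleR_left_diff_distrib right_diff_distrib)
        also have "\<dots> \<le> 2 ^ i * (2 * inverse (2 ^ h) * 2 ^ b)"
          using a q b by (intro mult_mono) auto
        also have "\<dots> = inverse (2 ^ n)"
          unfolding h_def depth_def by (simp add: power_add field_simps)
        finally show "dist (ratcomb eY (v n)) (T i \<xi>) \<le> inverse (2 ^ n)" .
      qed
      ultimately show "\<exists>r'. eta (\<lambda>n. r (prod_encode (i, n))) x = Some r' \<and> cauchy_rep eY r' = Some (T i \<xi>)"
        by blast
    qed
    moreover have "T \<in> UBT_dom"
      unfolding UBT_dom_def
    proof (intro CollectI conjI allI bl)
      fix x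
      have "norm (T i x) \<le> real s0 * \<bar>f x\<bar> * norm (rvec eY Y)" for i
        unfolding T_def norm_scaleR abs_mult using last_change_bounded[OF stab, of i]
        by (intro mult_right_mono) auto
      then show "bounded (range (\<lambda>i. norm (T i x)))"
        unfolding bounded_iff by auto
    qed
    ultimately obtain s where s: "G r = Some s" "s 0 \<in> UBT_map T"
      using G unfolding realizer_def nat_rep_def by (metis option.inject)
    have "last_change p i \<le> s 0" for i
    proof -
      \<comment> \<open>At z the functional attains its norm, so evaluating there recovers the
        factor \<open>last_change p i\<close> from the operator norm.\<close>
      have "norm (T i z) \<le> onorm (T i) * norm z" by (rule onorm[OF bl])
      also have "\<dots> \<le> real (s 0) * norm z"
        using s(2) unfolding UBT_map_def by (intro mult_right_mono) auto
      finally have "real (last_change p i) * norm (rvec eY Y) * norm z \<le> real (s 0) * norm z"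
        unfolding T_def using f(3) by (simp add: abs_mult mult.commute mult.left_commute)
      then have "real (last_change p i) * norm (rvec eY Y) \<le> real (s 0)"
        using f(4) by simp
      moreover have "real (last_change p i) * 1 \<le> real (last_change p i) * norm (rvec eY Y)"
        by (rule mult_left_mono[OF Y]) simp
      ultimately show ?thesis by simp
    qed
    then have "least_missing p (s 0) = m"
      by (rule least_missing_of_bound[OF stab m])
    moreover have "K p = Some r" unfolding K_def r_def ..
    moreover have "H (bpair p s) = Some (\<lambda>_. least_missing p (s 0))"
      unfolding H_def bpair_def by simp
    ultimately show "\<exists>q y. (case K p of None \<Rightarrow> None
         | Some r \<Rightarrow> (case G r of None \<Rightarrow> None | Some s \<Rightarrow> H (bpair p s))) = Some q \<and>
        nat_rep q = Some y \<and> y \<in> CN_map A"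
      using s m A(1) by (simp add: nat_rep_def CN_map_def)
  qed
  ultimately show ?thesis unfolding W_le_def by blast
qed

theorem theorem5p6:
  fixes eX :: "nat \<Rightarrow> 'x::banach" and eY :: "nat \<Rightarrow> 'y::banach"
  assumes "computable_banach eX" and "computable_banach eY"
    and "\<exists>x::'x. x \<noteq> 0" and "\<exists>y::'y. y \<noteq> 0"
  shows "W_equiv (seq_rep (fun_rep (cauchy_rep eX) (cauchy_rep eY))) nat_rep
                 (UBT_dom :: (nat \<Rightarrow> ('x \<Rightarrow> 'y)) set) UBT_map
                 neg_rep nat_rep CN_dom CN_map"
  unfolding W_equiv_def
  using UBT_le_CN[OF assms(1,2)] CN_le_UBT[OF assms] by blast

end
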